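(* Let $n\ge 1$, let $P\in\mathscr{P}_n$ be a polynomial which does not vanish in $|z|<1$, and let $B\in\mathcal{B}_n$ have parameters $\lambda_0,\lambda_1,\lambda_2$. Then for every $0\le p<\infty$ and every $R>1$, with $\sigma(z)=Rz$, $$\left\|B[P\circ\sigma](z)\right\|_p\le\frac{R^n|\Lambda_n|+|\lambda_0|}{\|1+z\|_p}\,\|P(z)\|_p .$$
   Context: $\mathscr{P}_n$ is the space of complex polynomials of degree at most $n$. For a polynomial $Q$, define $\|Q(z)\|_0:=\exp\left\{\frac1{2\pi}\int_0^{2\pi}\log|Q(e^{i\theta})|\,d\theta\right\}$ and, for $0<p<\infty$, $\|Q(z)\|_p:=\left\{\frac1{2\pi}\int_0^{2\pi}|Q(e^{i\theta})|^p\,d\theta\right\}^{1/p}$. $P\circ\sigma$ denotes the composite $(P\circ\sigma)(z)=P(\sigma(z))$. The class $\mathcal{B}_n$ consists of the operators $B$ carrying $P\in\mathscr{P}_n$ into $$B[P](z):=\lambda_0P(z)+\lambda_1\left(\frac{nz}{2}\right)\frac{P'(z)}{1!}+\lambda_2\left(\frac{nz}{2}\right)^2\frac{P''(z)}{2!},$$ where $\lambda_0,\lambda_1,\lambda_2\in\mathbb{C}$ are such that all the zeros of $U(z):=\lambda_0+\lambda_1\binom n1 z+\lambda_2\binom n2 z^2$ lie in the half plane $|z|\le|z-n/2|$. Also $\Lambda_n:=\lambda_0+\lambda_1\frac{n^2}{2}+\lambda_2\frac{n^3(n-1)}{8}$. *)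

theory Defs
  imports "HOL-Analysis.Analysis" "HOL-Computational_Algebra.Polynomial"
begin

text \<open>
  For \<open>p = 0\<close> the zero polynomial is treated separately: its logarithmic mean is
  \<open>exp (-\<infinity>) = 0\<close>, whereas \<open>ln 0 = 0\<close> would yield \<open>1\<close>. For \<open>Q \<noteq> 0\<close> the value of
  \<open>ln\<close> at \<open>0\<close> is only used at the finitely many zeros of \<open>Q\<close> on the unit circle.
  Only \<open>p \<ge> 0\<close> is meaningful.
\<close>

definition circle_norm :: "real \<Rightarrow> complex poly \<Rightarrow> real" where
  "circle_norm p Q =
    (if p = 0 then
       (if Q = 0 then 0
        else exp (1 / (2 * pi) * (LBINT \<theta>:{0..2*pi}. ln (cmod (poly Q (cis \<theta>))))))
     else
       (1 / (2 * pi) * (LBINT \<theta>:{0..2*pi}. cmod (poly Q (cis \<theta>)) powr p)) powr (1 / p))"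

definition B_op :: "nat \<Rightarrow> complex \<Rightarrow> complex \<Rightarrow> complex \<Rightarrow> complex poly \<Rightarrow> complex poly" where
  "B_op n l0 l1 l2 P =
     smult l0 P
   + smult l1 ([:0, of_nat n / 2:] * smult (1 / fact 1) (pderiv P))
   + smult l2 ([:0, of_nat n / 2:] ^ 2 * smult (1 / fact 2) (pderiv (pderiv P)))"

definition U_poly :: "nat \<Rightarrow> complex \<Rightarrow> complex \<Rightarrow> complex \<Rightarrow> complex poly" where
  "U_poly n l0 l1 l2 = [:l0, l1 * of_nat (n choose 1), l2 * of_nat (n choose 2):]"

text \<open>
  The parameters for which \<open>B_op n l0 l1 l2\<close> belongs to the class \<open>\<B>\<^sub>n\<close>. Every point is
  a zero of \<open>U\<close> when \<open>U = 0\<close>, so that case is excluded for \<open>n \<ge> 1\<close>; nonzero constant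
  \<open>U\<close> is admitted.
\<close>

definition B_params :: "nat \<Rightarrow> complex \<Rightarrow> complex \<Rightarrow> complex \<Rightarrow> bool" where
  "B_params n l0 l1 l2 \<longleftrightarrow>
     (\<forall>z. poly (U_poly n l0 l1 l2) z = 0 \<longrightarrow> cmod z \<le> cmod (z - of_nat n / 2))"

definition Lam :: "nat \<Rightarrow> complex \<Rightarrow> complex \<Rightarrow> complex \<Rightarrow> complex" where
  "Lam n l0 l1 l2 =
     l0 + l1 * (of_nat n ^ 2 / 2) + l2 * (of_nat n ^ 3 * (of_nat n - 1) / 8)"

end

theory Submission
  imports Defs "HOL-Complex_Analysis.Complex_Analysis" "HOL-Library.Real_Mod"
    "HOL-Computational_Algebra.Fundamental_Theorem_Algebra"
begin

text \<open>
  Write \<open>F = B[P \<circ> \<sigma>]\<close>, \<open>P\<^sup>*(z) = z\<^sup>n cnj (P (1 / cnj z))\<close> for the reversal of \<open>P\<close>, and \<open>G\<close> for the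
  reversal of \<open>B[P\<^sup>* \<circ> \<sigma>]\<close>. Both \<open>F\<close> and \<open>G\<close> arise from \<open>P\<close> by multiplying the coefficients with
  fixed sequences, and in \<open>F\<close> the constant coefficient is multiplied by \<open>\<lambda>\<^sub>0\<close>, in \<open>G\<close> by
  \<open>R\<^sup>n cnj \<Lambda>\<^sub>n\<close>. For \<open>P\<close> without zeros in the open unit disc three things happen.

  \<^item> \<open>G\<close> has no zeros in \<open>|z| < R\<close> (\<open>dual_symbol_multiplier_nonzero\<close>). With \<open>P = c \<Prod> (1 - \<rho>\<^sub>j z)\<close> and
    \<open>w\<^sub>j = 1 / (1 - \<rho>\<^sub>j z)\<close> the quotient \<open>G(R z) / (R\<^sup>n P(z))\<close> is the polar form, in the variables
    \<open>w\<^sub>j\<close>, of \<open>U(n w / 2)\<close> with conjugated coefficients. For \<open>|z| < 1\<close> the \<open>w\<^sub>j\<close> lie in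
    \<open>Re w > 1/2\<close>, the zeros of the quadratic in the complementary half plane, and the Grace-Walsh
    phenomenon, which has an elementary proof for quadratics, forbids the polar form to vanish.

  \<^item> \<open>|F| \<le> |G|\<close> on the closed disc (\<open>B_op_le_dual\<close>): an operator that keeps polynomials free of
    zeros in the disc respects domination by such polynomials, and \<open>|P\<^sup>*| \<le> |P|\<close>.

  \<^item> Hence for \<open>|\<omega>| > 1\<close> the operator \<open>P \<mapsto> F + \<omega> G\<close> again keeps polynomials free of zeros in the
    disc.

  A theorem of Arestov (\<open>arestov\<close>) says that an operator of this kind multiplies the \<open>p\<close>-norm at
  most by the modulus of its constant-term multiplier, here
  \<open>|\<lambda>\<^sub>0 + \<omega> R\<^sup>n cnj \<Lambda>\<^sub>n| \<le> |\<lambda>\<^sub>0| + |\<omega>| R\<^sup>n |\<Lambda>\<^sub>n|\<close>. Averaging \<open>|F + \<omega> G|\<^sup>p\<close> over the circle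
  \<open>|\<omega>| = \<tau>\<close> gains the factor \<open>\<parallel>1 + z\<parallel>\<^sub>p\<^sup>p\<close>, because \<open>|F| \<le> |G|\<close>, and \<open>\<tau> \<rightarrow> 1\<close> gives the
  inequality for \<open>p > 0\<close>. For \<open>p = 0\<close> Jensen's formula evaluates \<open>\<parallel>G\<parallel>\<^sub>0\<close> and \<open>\<parallel>P\<parallel>\<^sub>0\<close> as the moduli of
  the constant coefficients, and \<open>\<parallel>1 + z\<parallel>\<^sub>0 = 1\<close>.

  Arestov's theorem rests on the case \<open>p = 0\<close>, which is Jensen's formula together with domination.
  Applying that case to \<open>P + c e\<^sup>i\<^sup>t\<close> and averaging over \<open>t\<close> turns \<open>ln |P|\<close> into
  \<open>ln (max |P| c)\<close>, and these truncated logarithms superpose to \<open>|P|\<^sup>p\<close> when integrated over \<open>c\<close>.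
\<close>

section \<open>Polynomials without zeros in the open unit disc\<close>

text \<open>
  The disc rather than its exterior is kept free of zeros because then the degree may drop below
  \<open>n\<close>, which corresponds to zeros at infinity, without becoming an exceptional case.
\<close>

definition zero_free :: "complex poly \<Rightarrow> bool" where
  "zero_free P \<longleftrightarrow> (\<forall>z. cmod z < 1 \<longrightarrow> poly P z \<noteq> 0)"

lemma zero_free_not_0: "zero_free P \<Longrightarrow> P \<noteq> 0"
  by (auto simp: zero_free_def dest: spec[of _ 0])

lemma zero_free_mult_iff: "zero_free (P * Q) \<longleftrightarrow> zero_free P \<and> zero_free Q"
  by (auto simp: zero_free_def)

lemma zero_free_linear: "cmod a \<le> 1 \<Longrightarrow> zero_free [:1, -a:]"
proof -
  assume a: "cmod a \<le> 1"
  have "z * a \<noteq> 1" if "cmod z < 1" for z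
  proof
    assume "z * a = 1"
    hence "cmod z * cmod a = 1" by (metis norm_mult norm_one)
    moreover have "cmod z * cmod a \<le> cmod z * 1" using a by (intro mult_left_mono) auto
    ultimately show False using that by simp
  qed
  then show ?thesis by (auto simp: zero_free_def)
qed

lemma poly_root_factor:
  fixes P :: "complex poly"
  assumes "degree P \<noteq> 0"
  obtains a Q where "P = [:-a, 1:] * Q" "degree P = Suc (degree Q)" "Q \<noteq> 0"
proof -
  from assms have "\<not> constant (poly P)" by (simp add: constant_degree)
  then obtain a where "poly P a = 0" using fundamental_theorem_of_algebra by blast
  then obtain Q where Q: "P = [:-a, 1:] * Q" by (metis dvdE poly_eq_0_iff_dvd)
  with assms have "Q \<noteq> 0" by auto
  then have "degree P = Suc (degree Q)" unfolding Q by (subst degree_mult_eq) auto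
  with Q \<open>Q \<noteq> 0\<close> that show ?thesis by blast
qed

text \<open>
  All zeros have modulus at least \<open>1\<close>, so their inverses \<open>\<rho>\<^sub>j\<close> lie in the closed disc. Padding with
  \<open>\<rho>\<^sub>j = 0\<close> gives exactly \<open>n\<close> factors whatever the degree is, as the polar form of an operator
  on polynomials of degree at most \<open>n\<close> requires.
\<close>

lemma zero_free_factorization:
  assumes "zero_free P" "degree P \<le> n"
  obtains c \<rho> where "c \<noteq> 0" "\<And>j. cmod (\<rho> j) \<le> 1" "P = smult c (\<Prod>j<n. [:1, -\<rho> j:])"
proof -
  have "\<exists>c \<rho>. c \<noteq> 0 \<and> (\<forall>j. cmod (\<rho> j) \<le> 1) \<and> P = smult c (\<Prod>j<n. [:1, -\<rho> j:])"
    using assms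
  proof (induction n arbitrary: P)
    case 0
    then obtain c where "P = [:c:]" by (metis degree_eq_zeroE le_zero_eq)
    moreover have "c \<noteq> 0" using zero_free_not_0[OF 0(1)] calculation by auto
    ultimately show ?case by (intro exI[of _ c] exI[of _ "\<lambda>_. 0"]) (auto simp: smult_one)
  next
    case (Suc n)
    show ?case
    proof (cases "degree P = 0")
      case True
      then obtain c where "P = [:c:]" by (metis degree_eq_zeroE)
      moreover have "c \<noteq> 0" using zero_free_not_0[OF Suc(2)] calculation by auto
      moreover have "(\<Prod>j<k. [:1, -(0::complex):]) = 1" for k :: nat
        by (induction k) auto
      ultimately show ?thesis
        by (intro exI[of _ c] exI[of _ "\<lambda>_. 0"]) (simp add: smult_one)
    next
      case False
      then obtain a Q where Q: "P = [:-a, 1:] * Q" "degree P = Suc (degree Q)" "Q \<noteq> 0"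
        by (rule poly_root_factor)
      have a: "cmod a \<ge> 1"
        using Suc(2) Q(1) by (force simp: zero_free_def not_le[symmetric])
      hence a0: "a \<noteq> 0" by auto
      have "zero_free Q" "degree Q \<le> n" using Suc(2,3) Q(2) unfolding Q(1) zero_free_mult_iff by auto
      from Suc.IH[OF this] obtain c \<rho>
        where c: "c \<noteq> 0" "\<And>j. cmod (\<rho> j) \<le> 1" "Q = smult c (\<Prod>j<n. [:1, -\<rho> j:])" by blast
      define \<rho>' where "\<rho>' = \<rho>(n := 1 / a)"
      have "(\<Prod>j<Suc n. [:1, -\<rho>' j:]) = (\<Prod>j<n. [:1, -\<rho> j:]) * [:1, -1/a:]"
        by (simp add: \<rho>'_def)
      moreover have "[:-a, 1:] = smult (-a) [:1, -1/a:]" using a0 by simp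
      ultimately have "P = smult (-a * c) (\<Prod>j<Suc n. [:1, -\<rho>' j:])"
        unfolding Q(1) c(3) by (simp only: mult_smult_left mult_smult_right smult_smult mult_ac)
      moreover have "cmod (\<rho>' j) \<le> 1" for j
        using c(2) a a0 by (auto simp: \<rho>'_def norm_divide divide_le_eq)
      ultimately show ?thesis using c(1) a0
        by (intro exI[of _ "-a * c"] exI[of _ \<rho>']) auto
    qed
  qed
  then show ?thesis using that by blast
qed

lemma blaschke_factor:
  "cmod (1 - cnj a * z) ^ 2 - cmod (z - a) ^ 2 = (1 - cmod a ^ 2) * (1 - cmod z ^ 2)"
proof -
  have "complex_of_real (cmod (1 - cnj a * z) ^ 2 - cmod (z - a) ^ 2)
      = complex_of_real ((1 - cmod a ^ 2) * (1 - cmod z ^ 2))"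
    by (simp only: of_real_diff of_real_mult complex_norm_square of_real_1 complex_cnj_diff
        complex_cnj_mult complex_cnj_one complex_cnj_cnj) (simp add: algebra_simps)
  then show ?thesis by (simp only: of_real_eq_iff)
qed

lemma cmod_diff_le_reflected:
  assumes "cmod a \<le> 1" "cmod z \<le> 1"
  shows "cmod (z - a) \<le> cmod (1 - cnj a * z)"
proof (rule power2_le_imp_le)
  have "0 \<le> (1 - cmod a ^ 2) * (1 - cmod z ^ 2)"
    using assms by (intro mult_nonneg_nonneg) (auto simp: power_le_one)
  then show "cmod (z - a) ^ 2 \<le> cmod (1 - cnj a * z) ^ 2" using blaschke_factor[of a z] by linarith
qed auto

lemma cmod_diff_eq_reflected:
  assumes "cmod z = 1"
  shows "cmod (z - a) = cmod (1 - cnj a * z)"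
  using blaschke_factor[of a z] assms by (simp add: power2_eq_iff_nonneg)

text \<open>
  Each zero \<open>a\<close> in the open disc is reflected in the unit circle: replacing \<open>z - a\<close> by
  \<open>1 - cnj a z\<close> keeps the modulus on the circle and can only increase it inside.
\<close>

lemma zero_free_majorant:
  assumes "P \<noteq> 0"
  obtains P1 where "zero_free P1" "degree P1 \<le> degree P"
    "\<And>z. cmod z \<le> 1 \<Longrightarrow> cmod (poly P z) \<le> cmod (poly P1 z)"
    "\<And>z. cmod z = 1 \<Longrightarrow> cmod (poly P z) = cmod (poly P1 z)"
proof -
  have "\<exists>P1. zero_free P1 \<and> degree P1 \<le> degree P \<and>
    (\<forall>z. cmod z \<le> 1 \<longrightarrow> cmod (poly P z) \<le> cmod (poly P1 z)) \<and>
    (\<forall>z. cmod z = 1 \<longrightarrow> cmod (poly P z) = cmod (poly P1 z))" using assms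
  proof (induction "degree P" arbitrary: P)
    case 0
    then have "zero_free P" by (metis degree_eq_zeroE mult_zero_right pCons_0_0 poly_pCons
          poly_0 zero_free_def add.right_neutral)
    then show ?case by blast
  next
    case (Suc m)
    then obtain a Q where Q: "P = [:-a, 1:] * Q" "degree P = Suc (degree Q)" "Q \<noteq> 0"
      by (metis poly_root_factor nat.distinct(1))
    with Suc obtain Q1 where Q1: "zero_free Q1" "degree Q1 \<le> degree Q"
      "\<And>z. cmod z \<le> 1 \<Longrightarrow> cmod (poly Q z) \<le> cmod (poly Q1 z)"
      "\<And>z. cmod z = 1 \<Longrightarrow> cmod (poly Q z) = cmod (poly Q1 z)"
      by (metis nat.inject)
    define L where "L = (if cmod a \<ge> 1 then [:-a, 1:] else [:1, -cnj a:])"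
    have "zero_free L" using zero_free_linear[of "cnj a"]
      by (auto simp: L_def zero_free_def add_eq_0_iff)
    moreover have "degree (L * Q1) \<le> degree P"
    proof -
      have "degree (L * Q1) \<le> degree L + degree Q1" by (rule degree_mult_le)
      moreover have "degree L \<le> 1" by (auto simp: L_def)
      ultimately show ?thesis using Q Q1 by linarith
    qed
    moreover have "cmod (poly [:-a, 1:] z) \<le> cmod (poly L z)" if "cmod z \<le> 1" for z
      using cmod_diff_le_reflected[of a z] that by (auto simp: L_def algebra_simps)
    moreover have "cmod (poly [:-a, 1:] z) = cmod (poly L z)" if "cmod z = 1" for z
      using cmod_diff_eq_reflected[of z a] that by (auto simp: L_def algebra_simps)
    ultimately show ?case using Q1 unfolding Q(1)
      by (intro exI[of _ "L * Q1"])
        (auto simp: zero_free_mult_iff norm_mult poly_mult simp del: poly_pCons mult_pCons_left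
          intro!: mult_mono)
  qed
  then show ?thesis using that by blast
qed

section \<open>Coefficient multipliers that keep the disc free of zeros\<close>

definition multiplier :: "(nat \<Rightarrow> complex) \<Rightarrow> complex poly \<Rightarrow> complex poly" where
  "multiplier \<gamma> P = (\<Sum>k\<le>degree P. monom (\<gamma> k * coeff P k) k)"

lemma coeff_multiplier [simp]: "coeff (multiplier \<gamma> P) k = \<gamma> k * coeff P k"
  by (auto simp: multiplier_def coeff_sum coeff_eq_0 if_distrib cong: if_cong)

lemma multiplier_diff: "multiplier \<gamma> (P - Q) = multiplier \<gamma> P - multiplier \<gamma> Q"
  by (rule poly_eqI) (simp add: algebra_simps)

lemma multiplier_add: "multiplier \<gamma> (P + Q) = multiplier \<gamma> P + multiplier \<gamma> Q"
  by (rule poly_eqI) (simp add: algebra_simps)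

lemma multiplier_smult: "multiplier \<gamma> (smult c P) = smult c (multiplier \<gamma> P)"
  by (rule poly_eqI) (simp add: algebra_simps)

lemma multiplier_const: "multiplier \<gamma> [:c:] = [:\<gamma> 0 * c:]"
  by (rule poly_eqI) (simp add: coeff_pCons split: nat.split)

lemma degree_multiplier_le: "degree (multiplier \<gamma> P) \<le> degree P"
  by (rule degree_le) (simp add: coeff_eq_0)

lemma poly_multiplier_0: "poly (multiplier \<gamma> P) 0 = \<gamma> 0 * poly P 0"
  by (simp add: poly_0_coeff_0)

lemma closure_punctured_disc: "closure (ball 0 1 - {0}) = cball (0::complex) 1"
proof -
  have "\<exists>y\<in>ball 0 1 - {0}. dist y (0::complex) < e" if "e > 0" for e :: real
    using that by (intro bexI[of _ "complex_of_real (min (e / 2) (1 / 2))"]) (auto simp: norm_mult)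
  then have "0 \<in> closure (ball 0 1 - {0::complex})"
    by (simp add: closure_approachable)
  then have "ball (0::complex) 1 \<subseteq> closure (ball 0 1 - {0})"
    using closure_subset[of "ball 0 1 - {0::complex}"] by auto
  then have "closure (ball 0 1 - {0}) = closure (ball (0::complex) 1)"
    by (intro antisym closure_mono closure_minimal) auto
  then show ?thesis by simp
qed

text \<open>
  Evaluating a reversed polynomial needs \<open>z \<noteq> 0\<close>, and zero-freeness is known only in the open disc;
  by continuity estimates extend from the punctured open disc to the closed disc.
\<close>

lemma poly_le_cball:
  assumes "\<And>z. 0 < cmod z \<Longrightarrow> cmod z < 1 \<Longrightarrow> cmod (poly p z) \<le> cmod (poly q z)"
    and "cmod z \<le> 1"
  shows "cmod (poly p z) \<le> cmod (poly q z)"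
proof -
  have "cmod (poly p z) - cmod (poly q z) \<le> 0"
  proof (rule continuous_le_on_closure[where f = "\<lambda>z. cmod (poly p z) - cmod (poly q z)"
        and S = "ball 0 1 - {0}"])
    show "continuous_on (closure (ball 0 1 - {0})) (\<lambda>z. cmod (poly p z) - cmod (poly q z))"
      by (intro continuous_intros)
    show "z \<in> closure (ball 0 1 - {0})" using assms(2)
      by (simp add: closure_punctured_disc)
  next
    fix y :: complex assume "y \<in> ball 0 1 - {0}"
    then show "cmod (poly p y) - cmod (poly q y) \<le> 0" using assms(1)[of y] by auto
  qed
  then show ?thesis by simp
qed

definition preserves_zero_free :: "nat \<Rightarrow> (nat \<Rightarrow> complex) \<Rightarrow> bool" where
  "preserves_zero_free n \<gamma> \<longleftrightarrow>
     (\<forall>P. degree P \<le> n \<longrightarrow> zero_free P \<longrightarrow> zero_free (multiplier \<gamma> P))"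

text \<open>
  If the conclusion failed at some \<open>z\<close> in the disc, then some \<open>P - \<beta> P1\<close> with \<open>|\<beta>| > 1\<close> would have
  an image vanishing at \<open>z\<close>; but \<open>P - \<beta> P1\<close> itself has no zeros in the disc since \<open>|P| \<le> |P1|\<close>.
\<close>

lemma multiplier_comparison:
  assumes \<gamma>: "preserves_zero_free n \<gamma>" and deg: "degree P \<le> n" "degree P1 \<le> n"
    and P1: "zero_free P1" and le: "\<And>z. cmod z < 1 \<Longrightarrow> cmod (poly P z) \<le> cmod (poly P1 z)"
    and z: "cmod z \<le> 1"
  shows "cmod (poly (multiplier \<gamma> P) z) \<le> cmod (poly (multiplier \<gamma> P1) z)"
proof (rule poly_le_cball[OF _ z])
  fix z assume z: "cmod z < 1"
  show "cmod (poly (multiplier \<gamma> P) z) \<le> cmod (poly (multiplier \<gamma> P1) z)"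
  proof (rule ccontr)
    assume *: "\<not> ?thesis"
    have ne: "poly (multiplier \<gamma> P1) z \<noteq> 0"
      using \<gamma> deg P1 z by (auto simp: preserves_zero_free_def zero_free_def)
    define \<beta> where "\<beta> = poly (multiplier \<gamma> P) z / poly (multiplier \<gamma> P1) z"
    have \<beta>: "cmod \<beta> > 1" using * ne by (auto simp: \<beta>_def norm_divide)
    have "zero_free (P - smult \<beta> P1)"
      unfolding zero_free_def
    proof (intro allI impI notI)
      fix y assume y: "cmod y < 1" and "poly (P - smult \<beta> P1) y = 0"
      then have "cmod (poly P y) = cmod \<beta> * cmod (poly P1 y)" by (simp flip: norm_mult)
      moreover have "cmod (poly P1 y) > 0" using P1 y by (auto simp: zero_free_def)
      ultimately show False using le[OF y] \<beta> by auto
    qed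
    moreover have "degree (P - smult \<beta> P1) \<le> n"
      using deg by (intro degree_diff_le) auto
    ultimately have "zero_free (multiplier \<gamma> (P - smult \<beta> P1))"
      using \<gamma> by (auto simp: preserves_zero_free_def)
    then have "poly (multiplier \<gamma> (P - smult \<beta> P1)) z \<noteq> 0" using z by (auto simp: zero_free_def)
    then show False using ne by (simp add: multiplier_diff multiplier_smult \<beta>_def)
  qed
qed

lemma preserves_zero_free_0: "preserves_zero_free n \<gamma> \<Longrightarrow> \<gamma> 0 \<noteq> 0"
proof -
  assume "preserves_zero_free n \<gamma>"
  moreover have "zero_free [:1:]" by (simp add: zero_free_def)
  ultimately have "zero_free (multiplier \<gamma> [:1:])" by (auto simp: preserves_zero_free_def)
  then show ?thesis by (auto simp: multiplier_const dest: zero_free_not_0)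
qed

section \<open>Jensen's formula for linear polynomials\<close>

text \<open>
  Lebesgue measure on \<open>[0, 2 \<pi>]\<close>, realised as a density on the whole line: then its measurable
  sets are the Borel sets of the line, and functions of the angle are measurable and continuous
  without reference to the interval.
\<close>

definition angle_measure :: "real measure" where
  "angle_measure = density lborel (\<lambda>\<theta>. ennreal (indicator {0..2 * pi} \<theta>))"

lemma space_angle_measure [simp]: "space angle_measure = UNIV"
  by (simp add: angle_measure_def)

lemma sets_angle_measure [simp, measurable_cong]: "sets angle_measure = sets borel"
  by (simp add: angle_measure_def)

lemma measurable_cis [measurable]: "cis \<in> borel_measurable borel"
  by (intro borel_measurable_continuous_onI continuous_intros)

lemma emeasure_angle_measure: "emeasure angle_measure UNIV = ennreal (2 * pi)"
  by (simp add: angle_measure_def emeasure_density ennreal_indicator)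

lemma finite_angle_measure: "finite_measure angle_measure"
  by (rule finite_measureI) (simp add: emeasure_angle_measure)

interpretation angle: finite_measure angle_measure
  by (rule finite_angle_measure)

interpretation angle_pair: pair_sigma_finite angle_measure angle_measure ..

interpretation angle_lborel: pair_sigma_finite angle_measure lborel ..

lemma measure_angle_measure [simp]: "measure angle_measure UNIV = 2 * pi"
  by (simp add: measure_def emeasure_angle_measure)

lemma set_integral_angle: "(LBINT \<theta>:{0..2 * pi}. f \<theta>) = (\<integral>\<theta>. f \<theta> \<partial>angle_measure)"
  if "f \<in> borel_measurable borel" for f :: "real \<Rightarrow> real"
  using that by (simp add: set_lebesgue_integral_def angle_measure_def integral_density)

lemma integrable_angle_continuous:
  fixes f :: "real \<Rightarrow> real"
  assumes "continuous_on UNIV f"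
  shows "integrable angle_measure f"
proof -
  have "continuous_on {0..2 * pi} f" using assms continuous_on_subset by blast
  then have "set_integrable lborel {0..2 * pi} f" by (rule borel_integrable_atLeastAtMost')
  moreover have "f \<in> borel_measurable borel"
    using assms by (rule borel_measurable_continuous_onI)
  ultimately show ?thesis
    by (simp add: angle_measure_def set_integrable_def integrable_density)
qed

lemma integral_angle_eq:
  fixes f :: "real \<Rightarrow> real"
  assumes "continuous_on UNIV f" "(f has_integral x) {0..2 * pi}"
  shows "(\<integral>\<theta>. f \<theta> \<partial>angle_measure) = x"
proof -
  have "continuous_on {0..2 * pi} f" using assms continuous_on_subset by blast
  then have "set_integrable lborel {0..2 * pi} f" by (rule borel_integrable_atLeastAtMost')
  from set_borel_integral_eq_integral(2)[OF this] show ?thesis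
    using assms by (simp add: integral_unique borel_measurable_continuous_onI flip: set_integral_angle)
qed

lemma AE_angle_cis_neq: "AE \<theta> in angle_measure. cis \<theta> \<noteq> a"
proof -
  have "countable {\<theta>. cis \<theta> = a}"
  proof (cases "\<exists>b. cis b = a")
    case True
    then obtain b where b: "cis b = a" by blast
    have "{\<theta>. cis \<theta> = a} \<subseteq> range (\<lambda>n::int. b + of_int n * (2 * pi))"
    proof safe
      fix \<theta> assume "a = cis \<theta>"
      with b have "cis (\<theta> - b) = 1" by (simp flip: cis_divide)
      then obtain n where "\<theta> - b = of_int n * (2 * pi)" using cis_eq_1_iff by blast
      then show "\<theta> \<in> range (\<lambda>n::int. b + of_int n * (2 * pi))"
        by (intro range_eqI[of _ _ n]) simp
    qed
    then show ?thesis by (rule countable_subset) simp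
  next
    case False
    then have "{\<theta>. cis \<theta> = a} = {}" by auto
    then show ?thesis by simp
  qed
  then have "{\<theta>. cis \<theta> = a} \<in> null_sets lborel" by (rule countable_imp_null_set_lborel)
  then have "AE \<theta> in lborel. cis \<theta> \<noteq> a" by (auto dest: AE_not_in)
  then show ?thesis unfolding angle_measure_def by (subst AE_density) auto
qed

text \<open>
  The mean value property at \<open>0\<close> of the holomorphic function \<open>Ln (1 - a z)\<close>.
\<close>

lemma integral_ln_cmod_inside:
  assumes "cmod a < 1"
  shows "(\<integral>\<theta>. ln (cmod (1 - a * cis \<theta>)) \<partial>angle_measure) = 0"
proof (rule integral_angle_eq)
  have ne: "1 - a * z \<notin> \<real>\<^sub>\<le>\<^sub>0" if "cmod z \<le> 1" for z
  proof -
    have "cmod (a * z) < 1"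
      using assms that by (simp add: norm_mult) (meson le_less_trans mult_left_le norm_ge_zero)
    then have "Re (1 - a * z) > 0" using complex_Re_le_cmod[of "a * z"] by simp
    then show ?thesis by (auto simp: complex_nonpos_Reals_iff)
  qed
  have ne0: "1 - a * cis t \<noteq> 0" for t using ne[of "cis t"] by auto
  show "continuous_on UNIV (\<lambda>\<theta>. ln (cmod (1 - a * cis \<theta>)))"
    using ne0 by (intro continuous_intros) auto
  have "(\<lambda>z. Ln (1 - a * z)) holomorphic_on cball 0 1"
    using ne by (intro holomorphic_intros) auto
  from Cauchy_integral_circlepath_simple[OF this, of 0]
  have "((\<lambda>u. Ln (1 - a * u) / u) has_contour_integral 0) (part_circlepath 0 1 0 (2 * pi))"
    by (simp add: circlepath_def)
  then have "((\<lambda>t. Ln (1 - a * cis t) * \<i>) has_integral 0) {0..2 * pi}"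
    by (subst (asm) has_contour_integral_part_circlepath_iff) auto
  from has_integral_linear[OF this bounded_linear_Im]
  have "((\<lambda>t. Re (Ln (1 - a * cis t))) has_integral 0) {0..2 * pi}"
    by (simp add: o_def)
  then show "((\<lambda>\<theta>. ln (cmod (1 - a * cis \<theta>))) has_integral 0) {0..2 * pi}"
    using ne0 by simp
qed

text \<open>
  For \<open>|a| = 1\<close> the integrand is unbounded. The functions
  \<open>ln |1 - r a e\<^sup>i\<^sup>\<theta>| - ln r / 2 = ln (1/r + r - 2 Re (a e\<^sup>i\<^sup>\<theta>)) / 2\<close> decrease to it as \<open>r\<close> increases to \<open>1\<close>,
  so monotone convergence yields integrability and the value of the integral at once.
\<close>

lemma integral_ln_cmod_boundary:
  assumes "cmod a = 1"
  shows "has_bochner_integral angle_measure (\<lambda>\<theta>. ln (cmod (1 - a * cis \<theta>))) 0"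
proof -
  (* any sequence increasing to 1 inside (0, 1) would do *)
  define r :: "nat \<Rightarrow> real" where "r n = 1 - 1 / (real n + 2)" for n
  have r: "0 < r n" "r n < 1" for n by (auto simp: r_def field_simps)
  have r_mono: "r m \<le> r n" if "m \<le> n" for m n using that by (simp add: r_def frac_le)
  have r_lim: "r \<longlonglongrightarrow> 1" unfolding r_def by real_asymp
  define f where "f n \<theta> = ln (r n) / 2 - ln (cmod (1 - of_real (r n) * a * cis \<theta>))" for n \<theta>
  have ra: "cmod (of_real (r n) * a) < 1" for n using r[of n] assms by (simp add: norm_mult)
  have nz: "1 - of_real (r n) * a * cis \<theta> \<noteq> 0" for n \<theta>
  proof
    assume "1 - of_real (r n) * a * cis \<theta> = 0"
    then have "cmod (of_real (r n) * a * cis \<theta>) = 1" by simp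
    then show False using ra[of n] by (simp add: norm_mult)
  qed
  have cont: "continuous_on UNIV (\<lambda>\<theta>. ln (cmod (1 - of_real (r n) * a * cis \<theta>)))" for n
    using nz by (intro continuous_intros) auto
  have int: "integrable angle_measure (\<lambda>\<theta>. ln (cmod (1 - of_real (r n) * a * cis \<theta>)))" for n
    by (rule integrable_angle_continuous[OF cont])
  have sq: "cmod (1 - of_real s * a * cis \<theta>) ^ 2 = s * ((1 / s + s) - 2 * Re (a * cis \<theta>))"
    if "s > 0" for s \<theta>
  proof -
    define w where "w = a * cis \<theta>"
    have "cmod w = 1" by (simp add: w_def norm_mult assms)
    then have "(Re w)\<^sup>2 + (Im w)\<^sup>2 = 1" by (simp add: cmod_def)
    moreover have "(1 - s * Re w)\<^sup>2 + (s * Im w)\<^sup>2 = 1 - 2 * s * Re w + s\<^sup>2 * ((Re w)\<^sup>2 + (Im w)\<^sup>2)"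
      by (simp add: power2_eq_square algebra_simps)
    moreover have "s * ((1 / s + s) - 2 * Re w) = 1 - 2 * s * Re w + s\<^sup>2"
      using that by (simp add: power2_eq_square algebra_simps)
    ultimately have "(1 - s * Re w)\<^sup>2 + (s * Im w)\<^sup>2 = s * ((1 / s + s) - 2 * Re w)" by simp
    then show ?thesis by (simp add: cmod_power2 w_def mult.assoc)
  qed
  have f_eq: "f n \<theta> = - ln ((1 / r n + r n) - 2 * Re (a * cis \<theta>)) / 2" for n \<theta>
  proof -
    let ?g = "(1 / r n + r n) - 2 * Re (a * cis \<theta>)"
    have "r n * ?g > 0" using nz[of n \<theta>] sq[OF r(1), of n \<theta>] by (metis zero_less_norm_iff zero_less_power)
    then have g: "?g > 0" using r(1)[of n] by (metis zero_less_mult_pos)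
    have "2 * ln (cmod (1 - of_real (r n) * a * cis \<theta>)) = ln (cmod (1 - of_real (r n) * a * cis \<theta>) ^ 2)"
      using nz by (simp add: ln_realpow)
    also have "\<dots> = ln (r n) + ln ?g"
      unfolding sq[OF r(1)] by (rule ln_mult_pos[OF r(1) g])
    finally show ?thesis by (simp add: f_def)
  qed
  have "has_bochner_integral angle_measure (\<lambda>\<theta>. - ln (cmod (1 - a * cis \<theta>))) 0"
  proof (rule has_bochner_integral_monotone_convergence)
    show "integrable angle_measure (f n)" for n
      unfolding f_def using int by (intro Bochner_Integration.integrable_diff) auto
    show "AE \<theta> in angle_measure. mono (\<lambda>n. f n \<theta>)"
    proof (rule AE_I2, rule monoI)
      fix \<theta> :: real and m n :: nat assume "m \<le> n"
      have pos: "(1 / r n + r n) - 2 * Re (a * cis \<theta>) > 0"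
      proof -
        have "r n * ((1 / r n + r n) - 2 * Re (a * cis \<theta>)) > 0"
          using nz[of n \<theta>] sq[OF r(1), of n \<theta>] by (metis zero_less_norm_iff zero_less_power)
        then show ?thesis using r(1)[of n] by (metis zero_less_mult_pos)
      qed
      have "1 / r n + r n \<le> 1 / r m + r m"
      proof -
        have "0 \<le> (r n - r m) * (1 - r m * r n)"
          using r_mono[OF \<open>m \<le> n\<close>] r[of m] r[of n]
          by (intro mult_nonneg_nonneg) (auto intro!: mult_le_one)
        then have "(1 + (r n)\<^sup>2) * r m \<le> (1 + (r m)\<^sup>2) * r n"
          by (simp add: power2_eq_square algebra_simps)
        then have "(1 + (r n)\<^sup>2) / r n \<le> (1 + (r m)\<^sup>2) / r m"
          using r(1)[of m] r(1)[of n] by (simp add: divide_le_eq le_divide_eq mult_ac)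
        moreover have "(1 + (r k)\<^sup>2) / r k = 1 / r k + r k" for k
          using r(1)[of k] by (simp add: add_divide_distrib power2_eq_square)
        ultimately show ?thesis by simp
      qed
      then show "f m \<theta> \<le> f n \<theta>" using pos unfolding f_eq by simp
    qed
    show "AE \<theta> in angle_measure. (\<lambda>n. f n \<theta>) \<longlonglongrightarrow> - ln (cmod (1 - a * cis \<theta>))"
      using AE_angle_cis_neq[of "1 / a"]
    proof eventually_elim
      fix \<theta> assume *: "cis \<theta> \<noteq> 1 / a"
      have "a \<noteq> 0" using assms by auto
      with * have "1 - a * cis \<theta> \<noteq> 0" by (auto simp: field_simps)
      then have "(\<lambda>n. f n \<theta>) \<longlonglongrightarrow> ln 1 / 2 - ln (cmod (1 - of_real 1 * a * cis \<theta>))"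
        unfolding f_def by (intro tendsto_intros r_lim) auto
      then show "(\<lambda>n. f n \<theta>) \<longlonglongrightarrow> - ln (cmod (1 - a * cis \<theta>))" by simp
    qed
    have "integral\<^sup>L angle_measure (f n) = pi * ln (r n)" for n
      unfolding f_def using int integral_ln_cmod_inside[OF ra, of n]
      by (subst Bochner_Integration.integral_diff) auto
    moreover have "(\<lambda>n. pi * ln (r n)) \<longlonglongrightarrow> pi * ln 1"
      by (intro tendsto_intros r_lim) auto
    ultimately show "(\<lambda>n. integral\<^sup>L angle_measure (f n)) \<longlonglongrightarrow> 0" by simp
    show "(\<lambda>\<theta>. - ln (cmod (1 - a * cis \<theta>))) \<in> borel_measurable angle_measure"
      by measurable
  qed
  from has_bochner_integral_minus[OF this] show ?thesis by simp
qed

lemma has_integral_ln_cmod_unit: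
  assumes "cmod a \<le> 1"
  shows "has_bochner_integral angle_measure (\<lambda>\<theta>. ln (cmod (1 - a * cis \<theta>))) 0"
proof (cases "cmod a = 1")
  case False
  with assms have a: "cmod a < 1" by simp
  have "1 - a * cis t \<noteq> 0" for t
  proof
    assume "1 - a * cis t = 0"
    then have "cmod (a * cis t) = 1" by simp
    then show False using a by (simp add: norm_mult)
  qed
  then have "continuous_on UNIV (\<lambda>\<theta>. ln (cmod (1 - a * cis \<theta>)))"
    by (intro continuous_intros) auto
  from integrable_angle_continuous[OF this] integral_ln_cmod_inside[OF a]
  show ?thesis by (simp add: has_bochner_integral_iff)
qed (rule integral_ln_cmod_boundary)

text \<open>
  The larger of \<open>|w|\<close> and \<open>|d|\<close> is factored out; if it is \<open>|d|\<close>, then conjugating and multiplying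
  by \<open>e\<^sup>i\<^sup>\<theta>\<close> exchanges the roles of the two coefficients without changing the modulus.
\<close>

lemma jensen_affine:
  assumes "d \<noteq> 0"
  shows "has_bochner_integral angle_measure (\<lambda>\<theta>. ln (cmod (w + d * cis \<theta>)))
           (2 * pi * ln (max (cmod w) (cmod d)))"
proof -
  have main: "has_bochner_integral angle_measure (\<lambda>\<theta>. ln (cmod (w + d * cis \<theta>))) (2 * pi * ln (cmod w))"
    if "cmod d \<le> cmod w" "w \<noteq> 0" for w d
  proof -
    have "cmod (- d / w) \<le> 1" using that by (simp add: norm_divide)
    from has_bochner_integral_add[OF _ has_integral_ln_cmod_unit[OF this], of "\<lambda>_. ln (cmod w)" "2 * pi * ln (cmod w)"]
    have "has_bochner_integral angle_measure
       (\<lambda>\<theta>. ln (cmod w) + ln (cmod (1 - (- d / w) * cis \<theta>))) (2 * pi * ln (cmod w))"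
      by (simp add: has_bochner_integral_iff)
    moreover have "AE \<theta> in angle_measure. ln (cmod w) + ln (cmod (1 - (- d / w) * cis \<theta>)) =
             ln (cmod (w + d * cis \<theta>))"
      using AE_angle_cis_neq[of "- w / d"]
    proof eventually_elim
      fix \<theta> assume *: "cis \<theta> \<noteq> - w / d"
      have ne: "w + d * cis \<theta> \<noteq> 0"
      proof
        assume "w + d * cis \<theta> = 0"
        then have eq: "d * cis \<theta> = - w" by (simp add: add_eq_0_iff)
        with that(2) have "d \<noteq> 0" by auto
        with eq have "cis \<theta> = - w / d" by (metis nonzero_mult_div_cancel_left)
        with * show False by contradiction
      qed
      have eq: "w + d * cis \<theta> = w * (1 - (- d / w) * cis \<theta>)"
        using that(2) by (simp add: field_simps)
      with ne have "1 - (- d / w) * cis \<theta> \<noteq> 0" by auto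
      then show "ln (cmod w) + ln (cmod (1 - (- d / w) * cis \<theta>)) = ln (cmod (w + d * cis \<theta>))"
        unfolding eq norm_mult using that(2) by (subst ln_mult_pos) auto
    qed
    moreover have "(\<lambda>\<theta>. ln (cmod w) + ln (cmod (1 - (- d / w) * cis \<theta>))) \<in> borel_measurable angle_measure"
      "(\<lambda>\<theta>. ln (cmod (w + d * cis \<theta>))) \<in> borel_measurable angle_measure"
      by measurable
    ultimately show ?thesis using has_bochner_integral_cong_AE by blast
  qed
  show ?thesis
  proof (cases "cmod d \<le> cmod w")
    case True
    with assms have "w \<noteq> 0" by auto
    with main[OF True this] True show ?thesis by (simp add: max_def)
  next
    case False
    have "cmod (cnj d + cnj w * cis \<theta>) = cmod (w + d * cis \<theta>)" for \<theta>
    proof -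
      have "cmod (w + d * cis \<theta>) = cmod (cnj (w + d * cis \<theta>) * cis \<theta>)"
        by (simp only: norm_mult complex_mod_cnj norm_cis mult_1_right)
      also have "cnj (w + d * cis \<theta>) * cis \<theta> = cnj d * (cnj (cis \<theta>) * cis \<theta>) + cnj w * cis \<theta>"
        by (simp add: algebra_simps)
      also have "cnj (cis \<theta>) * cis \<theta> = 1" by (simp add: cis_cnj cis_mult)
      finally show ?thesis by simp
    qed
    with main[of "cnj w" "cnj d"] False assms show ?thesis by (simp add: max_def)
  qed
qed

section \<open>Multipliers and Mahler's measure\<close>

lemma AE_poly_cis_nonzero: "P \<noteq> 0 \<Longrightarrow> AE \<theta> in angle_measure. poly P (cis \<theta>) \<noteq> 0"
proof -
  assume "P \<noteq> 0"
  then have "finite {z. poly P z = 0}" by (rule poly_roots_finite)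
  then have "AE \<theta> in angle_measure. \<forall>z\<in>{z. poly P z = 0}. cis \<theta> \<noteq> z"
    by (subst AE_finite_all) (auto intro: AE_angle_cis_neq)
  then show ?thesis by (rule AE_mp) (auto intro!: AE_I2)
qed

lemma continuous_poly_cis: "continuous_on UNIV (\<lambda>\<theta>. poly P (cis \<theta>))"
  for P :: "complex poly"
  by (intro continuous_intros)

lemma measurable_poly_cis [measurable]: "(\<lambda>\<theta>. poly P (cis \<theta>)) \<in> borel_measurable borel"
  for P :: "complex poly"
  by (rule borel_measurable_continuous_onI[OF continuous_poly_cis])

text \<open>
  Jensen's formula: every factor \<open>1 - \<rho>\<^sub>j z\<close> with \<open>|\<rho>\<^sub>j| \<le> 1\<close> contributes \<open>0\<close>.
\<close>

lemma mahler_zero_free: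
  assumes "zero_free P"
  shows "has_bochner_integral angle_measure (\<lambda>\<theta>. ln (cmod (poly P (cis \<theta>))))
           (2 * pi * ln (cmod (poly P 0)))"
proof -
  define n where "n = degree P"
  obtain c \<rho> where c: "c \<noteq> 0" "\<And>j. cmod (\<rho> j) \<le> 1" "P = smult c (\<Prod>j<n. [:1, -\<rho> j:])"
    using zero_free_factorization[OF assms, of n] by (auto simp: n_def)
  have P: "poly P z = c * (\<Prod>j<n. 1 - \<rho> j * z)" for z
    unfolding c(3) by (simp add: poly_prod mult.commute)
  have "has_bochner_integral angle_measure
      (\<lambda>\<theta>. ln (cmod c) + (\<Sum>j<n. ln (cmod (1 - \<rho> j * cis \<theta>)))) (2 * pi * ln (cmod c) + (\<Sum>j<n. 0))"
    by (intro has_bochner_integral_add has_bochner_integral_sum has_integral_ln_cmod_unit c)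
      (simp add: has_bochner_integral_iff)
  moreover have "AE \<theta> in angle_measure. ln (cmod c) + (\<Sum>j<n. ln (cmod (1 - \<rho> j * cis \<theta>)))
     = ln (cmod (poly P (cis \<theta>)))"
    using AE_poly_cis_nonzero[OF zero_free_not_0[OF assms]]
  proof eventually_elim
    fix \<theta> assume "poly P (cis \<theta>) \<noteq> 0"
    then have nz: "1 - \<rho> j * cis \<theta> \<noteq> 0" if "j < n" for j using that by (auto simp: P)
    then show "ln (cmod c) + (\<Sum>j<n. ln (cmod (1 - \<rho> j * cis \<theta>))) = ln (cmod (poly P (cis \<theta>)))"
      unfolding P norm_mult prod_norm[symmetric] using c(1)
      by (subst ln_mult_pos) (auto intro!: prod_pos ln_prod[symmetric])
  qed
  moreover have "(\<lambda>\<theta>. ln (cmod c) + (\<Sum>j<n. ln (cmod (1 - \<rho> j * cis \<theta>)))) \<in> borel_measurable angle_measure"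
    "(\<lambda>\<theta>. ln (cmod (poly P (cis \<theta>)))) \<in> borel_measurable angle_measure"
    by measurable
  ultimately have "has_bochner_integral angle_measure (\<lambda>\<theta>. ln (cmod (poly P (cis \<theta>)))) (2 * pi * ln (cmod c))"
    using has_bochner_integral_cong_AE by fastforce
  then show ?thesis by (simp add: P)
qed

text \<open>
  Reflecting the zeros in the open disc does not change the integrand.
\<close>

lemma integrable_ln_poly:
  assumes "P \<noteq> 0"
  shows "integrable angle_measure (\<lambda>\<theta>. ln (cmod (poly P (cis \<theta>))))"
proof -
  obtain P1 where "zero_free P1"
    and eq: "\<And>z. cmod z = 1 \<Longrightarrow> cmod (poly P z) = cmod (poly P1 z)"
    using zero_free_majorant[OF assms] by metis
  from mahler_zero_free[OF this(1)] show ?thesis by (simp add: eq has_bochner_integral_iff)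
qed

text \<open>
  Reflecting zeros replaces \<open>P\<close> by a zero-free \<open>P1\<close> of equal modulus on the circle. This only
  increases the left-hand side, by comparison, and for \<open>P1\<close> both integrals are given by the values
  at \<open>0\<close>, whose quotient is \<open>\<gamma> 0\<close>.
\<close>

lemma mahler_multiplier:
  assumes \<gamma>: "preserves_zero_free n \<gamma>" and deg: "degree P \<le> n"
    and nz: "P \<noteq> 0" "multiplier \<gamma> P \<noteq> 0"
  shows "(\<integral>\<theta>. ln (cmod (poly (multiplier \<gamma> P) (cis \<theta>))) \<partial>angle_measure)
    \<le> 2 * pi * ln (cmod (\<gamma> 0)) + (\<integral>\<theta>. ln (cmod (poly P (cis \<theta>))) \<partial>angle_measure)"
proof -
  obtain P1 where P1: "zero_free P1" "degree P1 \<le> degree P"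
    and le: "\<And>z. cmod z \<le> 1 \<Longrightarrow> cmod (poly P z) \<le> cmod (poly P1 z)"
    and eq: "\<And>z. cmod z = 1 \<Longrightarrow> cmod (poly P z) = cmod (poly P1 z)"
    using zero_free_majorant[OF nz(1)] by blast
  have TP1: "zero_free (multiplier \<gamma> P1)"
    using \<gamma> P1 deg by (auto simp: preserves_zero_free_def)
  have P10: "poly P1 0 \<noteq> 0" using P1(1) by (auto simp: zero_free_def)
  have "(\<integral>\<theta>. ln (cmod (poly (multiplier \<gamma> P) (cis \<theta>))) \<partial>angle_measure)
     \<le> (\<integral>\<theta>. ln (cmod (poly (multiplier \<gamma> P1) (cis \<theta>))) \<partial>angle_measure)"
  proof (rule integral_mono_AE)
    show "AE \<theta> in angle_measure. ln (cmod (poly (multiplier \<gamma> P) (cis \<theta>)))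
            \<le> ln (cmod (poly (multiplier \<gamma> P1) (cis \<theta>)))"
      using AE_poly_cis_nonzero[OF nz(2)]
    proof eventually_elim
      fix \<theta> assume "poly (multiplier \<gamma> P) (cis \<theta>) \<noteq> 0"
      moreover have "cmod (poly (multiplier \<gamma> P) (cis \<theta>)) \<le> cmod (poly (multiplier \<gamma> P1) (cis \<theta>))"
        using deg P1 le by (intro multiplier_comparison[OF \<gamma>]) auto
      ultimately show "ln (cmod (poly (multiplier \<gamma> P) (cis \<theta>)))
            \<le> ln (cmod (poly (multiplier \<gamma> P1) (cis \<theta>)))"
        by (intro ln_mono) auto
    qed
  qed (use TP1 nz in \<open>auto intro!: integrable_ln_poly zero_free_not_0\<close>)
  also have "\<dots> = 2 * pi * ln (cmod (poly (multiplier \<gamma> P1) 0))"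
    using mahler_zero_free[OF TP1] by (rule has_bochner_integral_integral_eq)
  also have "\<dots> = 2 * pi * ln (cmod (\<gamma> 0)) + 2 * pi * ln (cmod (poly P1 0))"
    using P10 preserves_zero_free_0[OF \<gamma>]
    by (simp add: poly_multiplier_0 norm_mult ln_mult_pos algebra_simps)
  also have "2 * pi * ln (cmod (poly P1 0)) = (\<integral>\<theta>. ln (cmod (poly P1 (cis \<theta>))) \<partial>angle_measure)"
    using mahler_zero_free[OF P1(1)] by (rule has_bochner_integral_integral_eq[symmetric])
  also have "\<dots> = (\<integral>\<theta>. ln (cmod (poly P (cis \<theta>))) \<partial>angle_measure)"
    by (simp add: eq)
  finally show ?thesis .
qed

text \<open>
  Jensen's formula in \<open>t\<close>, for every fixed \<open>\<theta>\<close>, and Fubini. The integrand has logarithmic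
  singularities but is bounded above by some \<open>L\<close>, so \<open>2 L - ln |f + d e\<^sup>i\<^sup>t|\<close> dominates its absolute value,
  and the integral over \<open>t\<close> of this bound is known.
\<close>

lemma jensen_average:
  fixes f :: "real \<Rightarrow> complex"
  assumes d: "d \<noteq> 0" and [measurable]: "f \<in> borel_measurable borel" and B: "\<And>\<theta>. cmod (f \<theta>) \<le> B"
  shows "integrable angle_measure (\<lambda>t. \<integral>\<theta>. ln (cmod (f \<theta> + d * cis t)) \<partial>angle_measure)" (is ?I)
    and "(\<integral>t. (\<integral>\<theta>. ln (cmod (f \<theta> + d * cis t)) \<partial>angle_measure) \<partial>angle_measure)
      = 2 * pi * (\<integral>\<theta>. ln (max (cmod (f \<theta>)) (cmod d)) \<partial>angle_measure)" (is ?E)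
proof -
  define g where "g \<theta> t = ln (cmod (f \<theta> + d * cis t))" for \<theta> t
  have [measurable]: "case_prod g \<in> borel_measurable (angle_measure \<Otimes>\<^sub>M angle_measure)"
    unfolding g_def by measurable
  define L where "L = ln (B + cmod d + 1)"
  have B0: "0 \<le> B" using B[of 0] norm_ge_zero order_trans by blast
  have gL: "g \<theta> t \<le> L" for \<theta> t
  proof (cases "f \<theta> + d * cis t = 0")
    case True then show ?thesis using B0 by (simp add: g_def L_def)
  next
    case False
    have "cmod (f \<theta> + d * cis t) \<le> B + cmod d + 1"
      using norm_triangle_ineq[of "f \<theta>" "d * cis t"] B[of \<theta>] by (simp add: norm_mult)
    with False show ?thesis unfolding g_def L_def by (intro ln_mono) auto
  qed
  have hb: "has_bochner_integral angle_measure (g \<theta>) (2 * pi * ln (max (cmod (f \<theta>)) (cmod d)))" for \<theta>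
    unfolding g_def by (rule jensen_affine[OF d])
  have int: "integrable angle_measure (g \<theta>)" for \<theta>
    using hb by (auto simp: has_bochner_integral_iff)
  (* the bound is uniform in \<theta> because max (cmod (f \<theta>)) (cmod d) is at least cmod d *)
  have bound: "(\<integral>t. norm (g \<theta> t) \<partial>angle_measure) \<le> 2 * pi * (2 * L - ln (cmod d))" for \<theta>
  proof -
    have "(\<integral>t. norm (g \<theta> t) \<partial>angle_measure) \<le> (\<integral>t. 2 * L - g \<theta> t \<partial>angle_measure)"
    proof (rule integral_mono)
      fix t
      have "0 \<le> L" using B0 by (simp add: L_def)
      then show "norm (g \<theta> t) \<le> 2 * L - g \<theta> t" using gL[of \<theta> t] by auto
    qed (use int in auto)
    also have "\<dots> = 2 * pi * (2 * L) - 2 * pi * ln (max (cmod (f \<theta>)) (cmod d))"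
      using int has_bochner_integral_integral_eq[OF hb] by simp
    also have "\<dots> \<le> 2 * pi * (2 * L) - 2 * pi * ln (cmod d)"
      using d by (intro diff_left_mono mult_left_mono ln_mono) auto
    finally show ?thesis by (simp add: right_diff_distrib)
  qed
  have prod: "integrable (angle_measure \<Otimes>\<^sub>M angle_measure) (case_prod g)"
  proof (rule angle_pair.Fubini_integrable)
    have "(\<lambda>\<theta>. \<integral>t. norm (case_prod g (\<theta>, t)) \<partial>angle_measure) \<in> borel_measurable angle_measure"
      by measurable
    then show "integrable angle_measure (\<lambda>\<theta>. \<integral>t. norm (case_prod g (\<theta>, t)) \<partial>angle_measure)"
      using bound by (intro angle.integrable_const_bound[where B = "2 * pi * (2 * L - ln (cmod d))"])
        (auto intro!: AE_I2)
  qed (use int in auto)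
  show ?I using angle_pair.integrable_snd[OF prod] by (simp add: g_def)
  show ?E using angle_pair.Fubini_integral[OF prod]
    unfolding has_bochner_integral_integral_eq[OF hb] by (simp add: g_def)
qed

lemma bounded_poly_cis:
  fixes P :: "complex poly"
  obtains B where "\<And>\<theta>. cmod (poly P (cis \<theta>)) \<le> B"
proof -
  have "compact (poly P ` sphere 0 1)"
    by (intro compact_continuous_image continuous_intros) auto
  then obtain B where "\<And>z. z \<in> sphere 0 1 \<Longrightarrow> cmod (poly P z) \<le> B"
    by (meson bounded_iff compact_imp_bounded imageI)
  then show ?thesis by (intro that[of B]) auto
qed

text \<open>
  Adding a constant \<open>c e\<^sup>i\<^sup>t\<close> to \<open>P\<close> adds \<open>\<gamma> 0 c e\<^sup>i\<^sup>t\<close> to its image. The preceding inequality for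
  these polynomials is averaged over \<open>t\<close>; one value of \<open>e\<^sup>i\<^sup>t\<close>, for which the polynomial might vanish
  identically, has to be excluded.
\<close>

lemma truncated_mahler_multiplier:
  assumes \<gamma>: "preserves_zero_free n \<gamma>" and deg: "degree P \<le> n" and c: "c > 0"
  shows "(\<integral>\<theta>. ln (max (cmod (poly (multiplier \<gamma> P) (cis \<theta>))) (cmod (\<gamma> 0) * c)) \<partial>angle_measure)
    \<le> 2 * pi * ln (cmod (\<gamma> 0)) + (\<integral>\<theta>. ln (max (cmod (poly P (cis \<theta>))) c) \<partial>angle_measure)"
proof -
  define Q where "Q t = P + [:of_real c * cis t:]" for t
  have degQ: "degree (Q t) \<le> n" for t
    unfolding Q_def using deg by (intro degree_add_le) auto
  have Q: "poly (Q t) z = poly P z + of_real c * cis t" for t z by (simp add: Q_def)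
  have TQ: "poly (multiplier \<gamma> (Q t)) z = poly (multiplier \<gamma> P) z + (\<gamma> 0 * of_real c) * cis t" for t z
    by (simp add: Q_def multiplier_add multiplier_const mult.assoc)
  have \<gamma>0: "\<gamma> 0 \<noteq> 0" by (rule preserves_zero_free_0[OF \<gamma>])
  obtain B where B: "\<And>\<theta>. cmod (poly P (cis \<theta>)) \<le> B"
    using bounded_poly_cis[of P] by blast
  obtain B' where B': "\<And>\<theta>. cmod (poly (multiplier \<gamma> P) (cis \<theta>)) \<le> B'"
    using bounded_poly_cis[of "multiplier \<gamma> P"] by blast
  have c0: "complex_of_real c \<noteq> 0" "\<gamma> 0 * complex_of_real c \<noteq> 0" using c \<gamma>0 by auto
  note J = jensen_average[OF c0(1) measurable_poly_cis B]
  note J' = jensen_average[OF c0(2) measurable_poly_cis B']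
  have "(\<integral>t. (\<integral>\<theta>. ln (cmod (poly (multiplier \<gamma> P) (cis \<theta>) + (\<gamma> 0 * of_real c) * cis t)) \<partial>angle_measure) \<partial>angle_measure)
     \<le> (\<integral>t. 2 * pi * ln (cmod (\<gamma> 0)) +
          (\<integral>\<theta>. ln (cmod (poly P (cis \<theta>) + of_real c * cis t)) \<partial>angle_measure) \<partial>angle_measure)"
  proof (rule integral_mono_AE)
    show "AE t in angle_measure.
      (\<integral>\<theta>. ln (cmod (poly (multiplier \<gamma> P) (cis \<theta>) + (\<gamma> 0 * of_real c) * cis t)) \<partial>angle_measure)
      \<le> 2 * pi * ln (cmod (\<gamma> 0)) + (\<integral>\<theta>. ln (cmod (poly P (cis \<theta>) + of_real c * cis t)) \<partial>angle_measure)"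
      using AE_angle_cis_neq[of "- poly P 0 / of_real c"]
    proof eventually_elim
      fix t assume t: "cis t \<noteq> - poly P 0 / of_real c"
      have "poly (Q t) 0 \<noteq> 0"
      proof
        assume "poly (Q t) 0 = 0"
        then have "of_real c * cis t = - poly P 0" by (simp add: Q add_eq_0_iff)
        then have "cis t = - poly P 0 / of_real c" using c0(1) by (metis nonzero_mult_div_cancel_left)
        with t show False by contradiction
      qed
      then have "Q t \<noteq> 0" "multiplier \<gamma> (Q t) \<noteq> 0"
        using poly_multiplier_0[of \<gamma> "Q t"] \<gamma>0 by auto
      from mahler_multiplier[OF \<gamma> degQ this]
      show "(\<integral>\<theta>. ln (cmod (poly (multiplier \<gamma> P) (cis \<theta>) + (\<gamma> 0 * of_real c) * cis t)) \<partial>angle_measure)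
        \<le> 2 * pi * ln (cmod (\<gamma> 0)) + (\<integral>\<theta>. ln (cmod (poly P (cis \<theta>) + of_real c * cis t)) \<partial>angle_measure)"
        by (simp only: Q TQ)
    qed
  qed (use J(1) J'(1) in auto)
  also have "\<dots> = 2 * pi * (2 * pi * ln (cmod (\<gamma> 0))) +
     (\<integral>t. (\<integral>\<theta>. ln (cmod (poly P (cis \<theta>) + of_real c * cis t)) \<partial>angle_measure) \<partial>angle_measure)"
    using J(1) by simp
  finally have "2 * pi * (\<integral>\<theta>. ln (max (cmod (poly (multiplier \<gamma> P) (cis \<theta>))) (cmod (\<gamma> 0) * c)) \<partial>angle_measure)
    \<le> 2 * pi * (2 * pi * ln (cmod (\<gamma> 0)) + (\<integral>\<theta>. ln (max (cmod (poly P (cis \<theta>))) c) \<partial>angle_measure))"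
    unfolding J(2) J'(2) using c by (simp add: norm_mult distrib_left)
  then show ?thesis by (subst (asm) mult_le_cancel_left_pos) simp_all
qed

section \<open>Arestov's inequality\<close>

text \<open>
  The power \<open>u\<^sup>p\<close> as a superposition of the truncated logarithms \<open>max 0 (ln (u / c))\<close> at the levels
  \<open>c = e\<^sup>x\<close>. Substituting \<open>x = ln u - y\<close> separates the factor \<open>u\<^sup>p\<close> from the integral of
  \<open>y e\<^sup>-\<^sup>p\<^sup>y\<close> over \<open>y \<ge> 0\<close>. The form with \<open>max u (exp x)\<close> covers \<open>u = 0\<close> as well.
\<close>

lemma layer_cake_powr:
  fixes p :: real
  assumes p: "p > 0" and u: "u \<ge> 0"
  shows "(\<integral>\<^sup>+x. ennreal (exp (p * x) * (ln (max u (exp x)) - x)) \<partial>lborel) = ennreal (u powr p / p\<^sup>2)"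
proof (cases "u = 0")
  case True
  then have "ln (max u (exp x)) - x = 0" for x by simp
  then show ?thesis using True by simp
next
  case False
  with u have u: "u > 0" by simp
  have "(\<integral>\<^sup>+x. ennreal (exp (p * x) * (ln (max u (exp x)) - x)) \<partial>lborel)
    = (\<integral>\<^sup>+x. ennreal (exp (p * (ln u + (-1) * x)) * (ln (max u (exp (ln u + (-1) * x))) - (ln u + (-1) * x))) \<partial>lborel)"
    by (subst nn_integral_real_affine[where c = "-1" and t = "ln u"]) auto
  also have "\<dots> = (\<integral>\<^sup>+x. ennreal (u powr p) * (ennreal (x * exp (- p * x)) * indicator {0..} x) \<partial>lborel)"
  proof (rule nn_integral_cong)
    fix x :: real
    have "ln (max u (exp (ln u + (-1) * x))) - (ln u + (-1) * x) = max 0 x"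
    proof (cases "x \<ge> 0")
      case True
      then have "u * exp (- x) \<le> u" using u by (simp add: mult_le_cancel_left1)
      then show ?thesis using True u by (simp add: exp_diff exp_minus field_simps max_def)
    next
      case False
      then have "u < u * exp (- x)" using u by simp
      then show ?thesis using False u by (simp add: exp_diff exp_minus field_simps max_def ln_div)
    qed
    moreover have "exp (p * (ln u + (-1) * x)) = u powr p * exp (- p * x)"
      using u by (simp add: powr_def algebra_simps flip: exp_add)
    ultimately show "ennreal (exp (p * (ln u + (-1) * x)) * (ln (max u (exp (ln u + (-1) * x))) - (ln u + (-1) * x)))
      = ennreal (u powr p) * (ennreal (x * exp (- p * x)) * indicator {0..} x)"
      by (auto simp: indicator_def max_def mult_ac simp flip: ennreal_mult')
  qed
  also have "\<dots> = ennreal (u powr p) * (\<integral>\<^sup>+x. ennreal (x * exp (- p * x)) * indicator {0..} x \<partial>lborel)"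
    by (rule nn_integral_cmult) measurable
  also have "(\<integral>\<^sup>+x. ennreal (x * exp (- p * x)) * indicator {0..} x \<partial>lborel) = 0 - (- (0 / p + 1 / p\<^sup>2) * exp (- p * 0))"
  proof (rule nn_integral_FTC_atLeast[where F = "\<lambda>x. - (x / p + 1 / p\<^sup>2) * exp (- p * x)"])
    show "((\<lambda>x. - (x / p + 1 / p\<^sup>2) * exp (- p * x)) has_real_derivative x * exp (- p * x)) (at x)" for x
      using p by (auto intro!: derivative_eq_intros simp: field_simps power2_eq_square)
    show "((\<lambda>x. - (x / p + 1 / p\<^sup>2) * exp (- p * x)) \<longlongrightarrow> 0) at_top"
      using p by real_asymp
  qed (auto intro!: mult_nonneg_nonneg)
  finally show ?thesis by (simp flip: ennreal_mult')
qed


lemma continuous_on_powr_poly_cis: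
  fixes Q :: "complex poly"
  assumes "p > 0"
  shows "continuous_on UNIV (\<lambda>\<theta>. cmod (poly Q (cis \<theta>)) powr p)"
  using assms by (intro continuous_on_powr' continuous_intros) auto

text \<open>
  Since \<open>|\<cdot>|\<^sup>p\<close> is a positive superposition of truncated logarithms, the inequality for each
  truncated logarithm carries over after exchanging the integrations over the level and the angle.
\<close>

lemma arestov:
  assumes \<gamma>: "preserves_zero_free n \<gamma>" and deg: "degree P \<le> n" and p: "p > 0"
  shows "(\<integral>\<theta>. cmod (poly (multiplier \<gamma> P) (cis \<theta>)) powr p \<partial>angle_measure)
    \<le> cmod (\<gamma> 0) powr p * (\<integral>\<theta>. cmod (poly P (cis \<theta>)) powr p \<partial>angle_measure)"
proof -
  have \<gamma>0: "cmod (\<gamma> 0) > 0" using preserves_zero_free_0[OF \<gamma>] by simp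
  define F where "F \<theta> = cmod (poly (multiplier \<gamma> P) (cis \<theta>)) / cmod (\<gamma> 0)" for \<theta>
  define G where "G \<theta> = cmod (poly P (cis \<theta>))" for \<theta>
  have [measurable]: "F \<in> borel_measurable borel" "G \<in> borel_measurable borel"
    unfolding F_def G_def by measurable
  have cont: "continuous_on UNIV F" "continuous_on UNIV G"
    unfolding F_def G_def using \<gamma>0 by (intro continuous_intros; simp)+
  have nn: "F \<theta> \<ge> 0" "G \<theta> \<ge> 0" for \<theta> by (simp_all add: F_def G_def)
  define g where "g u x = ln (max u (exp x)) - x" for u x :: real
  have [measurable]: "case_prod g \<in> borel_measurable (borel \<Otimes>\<^sub>M borel)"
    unfolding g_def by measurable
  have g: "g u x \<ge> 0" for u x
  proof -
    have "ln (exp x) \<le> ln (max u (exp x))" by (intro ln_mono) auto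
    then show ?thesis by (simp add: g_def)
  qed
  have int_g: "integrable angle_measure (\<lambda>\<theta>. g (H \<theta>) x)" if "continuous_on UNIV H" for H x
  proof (rule integrable_angle_continuous)
    have "max (H \<theta>) (exp x) \<noteq> 0" for \<theta> by (metis exp_gt_zero less_max_iff_disj less_irrefl)
    then show "continuous_on UNIV (\<lambda>\<theta>. g (H \<theta>) x)"
      unfolding g_def using that by (intro continuous_intros) auto
  qed
  (* dividing the image by the modulus of its first multiplier makes the levels on both sides agree *)
  have level: "(\<integral>\<theta>. g (F \<theta>) x \<partial>angle_measure) \<le> (\<integral>\<theta>. g (G \<theta>) x \<partial>angle_measure)" for x
  proof -
    have eq: "ln (max (cmod (poly (multiplier \<gamma> P) (cis \<theta>))) (cmod (\<gamma> 0) * exp x))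
        = ln (cmod (\<gamma> 0)) + x + g (F \<theta>) x" for \<theta>
    proof -
      have "max (cmod (poly (multiplier \<gamma> P) (cis \<theta>))) (cmod (\<gamma> 0) * exp x) = cmod (\<gamma> 0) * max (F \<theta>) (exp x)"
        using \<gamma>0 by (simp add: F_def max_mult_distrib_left)
      moreover have "max (F \<theta>) (exp x) > 0" by (simp add: less_max_iff_disj)
      ultimately show ?thesis using \<gamma>0 by (simp add: ln_mult_pos g_def)
    qed
    have eq': "ln (max (cmod (poly P (cis \<theta>))) (exp x)) = x + g (G \<theta>) x" for \<theta>
      by (simp add: g_def G_def)
    show ?thesis
      using truncated_mahler_multiplier[OF \<gamma> deg exp_gt_zero[of x]] int_g[OF cont(1), of x] int_g[OF cont(2), of x]
      unfolding eq eq' by (simp add: algebra_simps)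
  qed
  have layer: "(\<integral>\<^sup>+\<theta>. ennreal (H \<theta> powr p / p\<^sup>2) \<partial>angle_measure)
     = (\<integral>\<^sup>+x. ennreal (exp (p * x) * (\<integral>\<theta>. g (H \<theta>) x \<partial>angle_measure)) \<partial>lborel)"
    if H: "continuous_on UNIV H" "\<And>\<theta>. H \<theta> \<ge> 0" for H
  proof -
    have [measurable]: "H \<in> borel_measurable borel"
      using H(1) by (rule borel_measurable_continuous_onI)
    have "(\<integral>\<^sup>+\<theta>. ennreal (H \<theta> powr p / p\<^sup>2) \<partial>angle_measure)
      = (\<integral>\<^sup>+\<theta>. (\<integral>\<^sup>+x. ennreal (exp (p * x) * g (H \<theta>) x) \<partial>lborel) \<partial>angle_measure)"
      unfolding g_def using p H(2) by (simp add: layer_cake_powr)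
    also have "\<dots> = (\<integral>\<^sup>+x. (\<integral>\<^sup>+\<theta>. ennreal (exp (p * x) * g (H \<theta>) x) \<partial>angle_measure) \<partial>lborel)"
      by (rule angle_lborel.Fubini'[symmetric]) measurable
    also have "\<dots> = (\<integral>\<^sup>+x. ennreal (exp (p * x) * (\<integral>\<theta>. g (H \<theta>) x \<partial>angle_measure)) \<partial>lborel)"
      using g int_g[OF H(1)] by (intro nn_integral_cong) (subst nn_integral_eq_integral; simp)
    finally show ?thesis .
  qed
  have int_p: "integrable angle_measure (\<lambda>\<theta>. H \<theta> powr p / p\<^sup>2)"
    if "continuous_on UNIV H" "\<And>\<theta>. H \<theta> \<ge> 0" for H
    using that p by (intro integrable_angle_continuous continuous_intros continuous_on_powr') auto
  have "(\<integral>\<^sup>+\<theta>. ennreal (F \<theta> powr p / p\<^sup>2) \<partial>angle_measure)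
     \<le> (\<integral>\<^sup>+\<theta>. ennreal (G \<theta> powr p / p\<^sup>2) \<partial>angle_measure)"
    unfolding layer[OF cont(1) nn(1)] layer[OF cont(2) nn(2)]
    by (intro nn_integral_mono ennreal_leI mult_left_mono level) auto
  then have "(\<integral>\<theta>. F \<theta> powr p / p\<^sup>2 \<partial>angle_measure) \<le> (\<integral>\<theta>. G \<theta> powr p / p\<^sup>2 \<partial>angle_measure)"
    using int_p[OF cont(1) nn(1)] int_p[OF cont(2) nn(2)]
    by (simp add: nn_integral_eq_integral integral_nonneg)
  then have "(\<integral>\<theta>. F \<theta> powr p \<partial>angle_measure) \<le> (\<integral>\<theta>. G \<theta> powr p \<partial>angle_measure)"
    using p by (simp add: divide_le_cancel)
  moreover have "F \<theta> powr p = cmod (poly (multiplier \<gamma> P) (cis \<theta>)) powr p / cmod (\<gamma> 0) powr p" for \<theta>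
    using \<gamma>0 by (simp add: F_def powr_divide)
  ultimately show ?thesis using \<gamma>0 by (simp add: G_def divide_le_eq mult.commute)
qed

section \<open>Non-vanishing of polarized quadratics\<close>

lemma Re_triple: "Re (y * T * cnj (y + T)) = (cmod y)\<^sup>2 * Re T + (cmod T)\<^sup>2 * Re y"
  unfolding cmod_power2 by (simp add: power2_eq_square algebra_simps)

text \<open>
  The double of the second elementary symmetric function \<open>e\<^sub>2\<close> is \<open>\<Sum>\<^sub>j y\<^sub>j (S - y\<^sub>j)\<close>, and \<open>S\<close> is the sum
  of \<open>y\<^sub>j\<close> and \<open>S - y\<^sub>j\<close>, both with positive real part. Hence \<open>e\<^sub>2 / e\<^sub>1\<close> has positive real part.
\<close>

lemma Re_pair_sum_pos:
  fixes y :: "nat \<Rightarrow> complex"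
  assumes n: "n \<ge> 2" and y: "\<And>j. j < n \<Longrightarrow> Re (y j) > 0"
  defines "S \<equiv> (\<Sum>j<n. y j)"
  shows "Re ((S\<^sup>2 - (\<Sum>j<n. (y j)\<^sup>2)) * cnj S) > 0"
proof -
  have "(S\<^sup>2 - (\<Sum>j<n. (y j)\<^sup>2)) * cnj S = (\<Sum>j<n. y j * (S - y j) * cnj (y j + (S - y j)))"
  proof -
    have "(\<Sum>j<n. y j * (S - y j)) = S\<^sup>2 - (\<Sum>j<n. (y j)\<^sup>2)"
      by (simp add: right_diff_distrib sum_subtractf power2_eq_square flip: sum_distrib_right S_def)
    then show ?thesis by (simp flip: sum_distrib_right)
  qed
  also have "Re \<dots> = (\<Sum>j<n. (cmod (y j))\<^sup>2 * Re (S - y j) + (cmod (S - y j))\<^sup>2 * Re (y j))"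
    by (simp only: Re_sum Re_triple)
  also have "\<dots> > 0"
  proof (rule sum_pos)
    fix j assume "j \<in> {..<n}"
    then have j: "j < n" by simp
    have "S - y j = (\<Sum>i\<in>{..<n} - {j}. y i)" using j by (simp add: S_def sum_diff1)
    then have "Re (S - y j) = (\<Sum>i\<in>{..<n} - {j}. Re (y i))" by (simp only: Re_sum)
    also have "\<dots> > 0"
    proof (rule sum_pos)
      have "card ({..<n} - {j}) > 0" using j n by simp
      then show "{..<n} - {j} \<noteq> {}" by (metis card.empty less_irrefl)
    qed (use y in auto)
    finally have "Re (S - y j) > 0" .
    moreover have "(cmod (y j))\<^sup>2 > 0" using y[OF j] by (cases "y j = 0") auto
    ultimately show "(cmod (y j))\<^sup>2 * Re (S - y j) + (cmod (S - y j))\<^sup>2 * Re (y j) > 0"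
      using y[OF j] by (intro add_pos_nonneg mult_pos_pos mult_nonneg_nonneg) auto
  qed (use n in \<open>auto simp: lessThan_empty_iff\<close>)
  finally show ?thesis .
qed

text \<open>
  Up to the factor \<open>n (n - 1) / 2\<close> the expression is the polar form of \<open>(s - a) (s - b)\<close>
  in \<open>n\<close> variables. Let \<open>b\<close> be the root with the larger real part and \<open>y\<^sub>j = s\<^sub>j - b\<close>. If the
  polar form vanished, then \<open>(a - b) (n - 1) e\<^sub>1(y) = 2 e\<^sub>2(y)\<close>, where \<open>e\<^sub>2(y) / e\<^sub>1(y)\<close> has positive
  real part and \<open>a - b\<close> does not.
\<close>

lemma polarized_quadratic_nonzero:
  fixes s :: "nat \<Rightarrow> complex" and h :: real
  assumes n: "n \<ge> 2" and s: "\<And>j. j < n \<Longrightarrow> Re (s j) > h"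
    and ab: "Re a \<le> h" "Re b \<le> h"
  defines "e1 \<equiv> (\<Sum>j<n. s j)" and "e2 \<equiv> ((\<Sum>j<n. s j)\<^sup>2 - (\<Sum>j<n. (s j)\<^sup>2)) / 2"
  shows "e2 - (a + b) * (of_nat n - 1) / 2 * e1 + a * b * (of_nat n * (of_nat n - 1) / 2) \<noteq> 0"
proof -
  have *: "e2 - (a + b) * (of_nat n - 1) / 2 * e1 + a * b * (of_nat n * (of_nat n - 1) / 2) \<noteq> 0"
    if le: "Re a \<le> Re b" "Re b \<le> h" for a b
  proof -
    define y where "y j = s j - b" for j
    define S where "S = (\<Sum>j<n. y j)"
    have y: "Re (y j) > 0" if "j < n" for j using s[OF that] le by (simp add: y_def)
    have pos: "Re ((S\<^sup>2 - (\<Sum>j<n. (y j)\<^sup>2)) * cnj S) > 0"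
      unfolding S_def by (rule Re_pair_sum_pos[OF n y])
    have S: "S = e1 - of_nat n * b" by (simp add: S_def y_def sum_subtractf e1_def)
    have sq: "(\<Sum>j<n. (y j)\<^sup>2) = (\<Sum>j<n. (s j)\<^sup>2) - 2 * b * e1 + of_nat n * b\<^sup>2"
      by (simp add: y_def power2_diff sum.distrib sum_subtractf e1_def sum_distrib_left algebra_simps)
    have key: "2 * (e2 - (a + b) * (of_nat n - 1) / 2 * e1 + a * b * (of_nat n * (of_nat n - 1) / 2))
       = (S\<^sup>2 - (\<Sum>j<n. (y j)\<^sup>2)) - (a - b) * (of_nat n - 1) * S"
      unfolding S sq e2_def e1_def[symmetric] by (simp add: field_simps power2_eq_square)
    show ?thesis
    proof
      assume "e2 - (a + b) * (of_nat n - 1) / 2 * e1 + a * b * (of_nat n * (of_nat n - 1) / 2) = 0"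
      from key[unfolded this] have eq: "S\<^sup>2 - (\<Sum>j<n. (y j)\<^sup>2) = (a - b) * (of_nat n - 1) * S" by simp
      have "(S\<^sup>2 - (\<Sum>j<n. (y j)\<^sup>2)) * cnj S = of_real ((real n - 1) * (cmod S)\<^sup>2) * (a - b)"
        unfolding eq by (simp only: of_real_mult complex_norm_square) simp
      then have "Re ((S\<^sup>2 - (\<Sum>j<n. (y j)\<^sup>2)) * cnj S) = (real n - 1) * (cmod S)\<^sup>2 * Re (a - b)"
        by simp
      also have "\<dots> \<le> 0" using le n by (intro mult_nonneg_nonpos) auto
      finally show False using pos by linarith
    qed
  qed
  show ?thesis using *[of a b] *[of b a] ab by (cases "Re a \<le> Re b") (auto simp: ac_simps)
qed

lemma complex_quadratic_factor:
  fixes c d e :: complex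
  assumes "c \<noteq> 0"
  obtains a b where "d = - c * (a + b)" "e = c * a * b"
proof -
  define D where "D = csqrt (d\<^sup>2 - 4 * c * e)"
  have D: "D * D = d * d - 4 * c * e"
    using power2_csqrt[of "d\<^sup>2 - 4 * c * e"] by (simp add: D_def power2_eq_square)
  show ?thesis
  proof (rule that[of "(- d + D) / (2 * c)" "(- d - D) / (2 * c)"])
    show "d = - c * ((- d + D) / (2 * c) + (- d - D) / (2 * c))" using assms by (simp add: field_simps)
    show "e = c * ((- d + D) / (2 * c)) * ((- d - D) / (2 * c))"
    proof -
      have "c * ((- d + D) / (2 * c)) * ((- d - D) / (2 * c)) = (d * d - D * D) / (4 * c)"
        using assms by (simp add: field_simps)
      also have "\<dots> = e" using assms by (simp add: D)
      finally show ?thesis by simp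
    qed
  qed
qed

lemma half_plane_iff:
  "cmod z \<le> cmod (z - of_nat n / 2) \<longleftrightarrow> Re z \<le> real n / 4" if "n \<ge> 1"
proof -
  have "cmod z \<le> cmod (z - of_nat n / 2) \<longleftrightarrow> (cmod z)\<^sup>2 \<le> (cmod (z - of_nat n / 2))\<^sup>2"
    by (simp add: power_mono_iff)
  also have "(cmod (z - of_nat n / 2))\<^sup>2 = (Re z - real n / 2)\<^sup>2 + (Im z)\<^sup>2"
    by (simp add: cmod_power2)
  also have "\<dots> = (cmod z)\<^sup>2 + real n * (real n / 4 - Re z)"
    unfolding cmod_power2 by (simp add: power2_eq_square algebra_simps)
  finally show ?thesis using that by (simp add: zero_le_mult_iff)
qed

lemma poly_U: "poly (U_poly n l0 l1 l2) z = l0 + l1 * of_nat n * z + l2 * (of_nat n * (of_nat n - 1) / 2) * z\<^sup>2"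
proof -
  have "(of_nat (n choose 2) :: complex) = of_nat n * (of_nat n - 1) / 2"
  proof -
    have "even (n * (n - 1))" by (cases n) auto
    then have "2 * (n choose 2) = n * (n - 1)" unfolding choose_two by (rule dvd_mult_div_cancel)
    then have "(of_nat (2 * (n choose 2)) :: complex) = of_nat (n * (n - 1))" by (rule arg_cong)
    then show ?thesis by (cases n) (simp_all add: field_simps)
  qed
  then show ?thesis unfolding U_poly_def by (simp only:) (simp add: algebra_simps power2_eq_square)
qed

text \<open>
  With \<open>s\<^sub>j = n w\<^sub>j / 2\<close> the expression is the polar form of \<open>U\<close>. When \<open>U\<close> has degree at most one,
  this is the value of \<open>U\<close> at the mean of the \<open>s\<^sub>j\<close>.
\<close>

lemma B_symbol_nonzero:
  fixes w :: "nat \<Rightarrow> complex"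
  assumes n: "n \<ge> 1" and B: "B_params n l0 l1 l2" and w: "\<And>j. j < n \<Longrightarrow> Re (w j) > 1 / 2"
  defines "e1 \<equiv> (\<Sum>j<n. w j)" and "e2 \<equiv> ((\<Sum>j<n. w j)\<^sup>2 - (\<Sum>j<n. (w j)\<^sup>2)) / 2"
  shows "l0 + l1 * (of_nat n / 2) * e1 + l2 * ((of_nat n)\<^sup>2 / 4) * e2 \<noteq> 0"
proof -
  have U: "Re z \<le> real n / 4"
    if "l0 + l1 * of_nat n * z + l2 * (of_nat n * (of_nat n - 1) / 2) * z\<^sup>2 = 0" for z
    using that B half_plane_iff[OF n, of z] by (auto simp: B_params_def poly_U)
  show ?thesis
  proof (cases "n = 1 \<or> l2 = 0")
    case True
    have "e2 = 0" if "n = 1" using that by (simp add: e2_def)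
    with True have zero: "l2 * e2 = 0" by auto
    have "(\<Sum>j<n. 1 / 2) < (\<Sum>j<n. Re (w j))"
      using n w by (intro sum_strict_mono) (auto simp: lessThan_empty_iff)
    then have "Re (e1 / 2) > real n / 4" by (simp add: e1_def)
    then have "l0 + l1 * of_nat n * (e1 / 2) + l2 * (of_nat n * (of_nat n - 1) / 2) * (e1 / 2)\<^sup>2 \<noteq> 0"
      using U[of "e1 / 2"] by auto
    with True zero show ?thesis by auto
  next
    case False
    then have n2: "n \<ge> 2" "l2 \<noteq> 0" using n by auto
    define c where "c = l2 * (of_nat n * (of_nat n - 1) / 2)"
    have n1: "(of_nat n - 1 :: complex) \<noteq> 0" using n2 by (simp add: of_nat_eq_1_iff)
    have c: "c \<noteq> 0" using n2 n1 by (simp add: c_def)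
    obtain a b where ab: "l1 * of_nat n = - c * (a + b)" "l0 = c * a * b"
      using complex_quadratic_factor[OF c] by metis
    have Ueq: "l0 + l1 * of_nat n * z + l2 * (of_nat n * (of_nat n - 1) / 2) * z\<^sup>2 = c * (z - a) * (z - b)" for z
      unfolding c_def[symmetric] ab by (simp add: algebra_simps power2_eq_square)
    have re: "Re a \<le> real n / 4" "Re b \<le> real n / 4" using U[of a] U[of b] unfolding Ueq by auto
    define s where "s j = of_nat n / 2 * w j" for j
    have s: "Re (s j) > real n / 4" if "j < n" for j
      using w[OF that] n by (simp add: s_def field_simps)
    note main = polarized_quadratic_nonzero[where s = s, OF n2(1) s re]
    have s1: "(\<Sum>j<n. s j) = of_nat n / 2 * e1" by (simp add: s_def e1_def sum_distrib_left)
    have s2: "(\<Sum>j<n. (s j)\<^sup>2) = (of_nat n)\<^sup>2 / 4 * (\<Sum>j<n. (w j)\<^sup>2)"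
      by (simp add: s_def sum_distrib_left power_mult_distrib power_divide)
    define X where "X = of_nat n * (of_nat n - 1) / (2 :: complex)"
    have X: "X \<noteq> 0" using n2 n1 by (simp add: X_def)
    have cX: "c = l2 * X" by (simp add: c_def X_def)
    have "X * (l0 + l1 * (of_nat n / 2) * e1 + l2 * ((of_nat n)\<^sup>2 / 4) * e2)
      = c * ((of_nat n)\<^sup>2 / 4 * e2) + (l1 * of_nat n) * (X / 2) * e1 + X * l0"
      by (simp add: cX algebra_simps)
    also have "\<dots> = c * ((of_nat n)\<^sup>2 / 4 * e2 - (a + b) * (of_nat n - 1) / 2 * (of_nat n / 2 * e1) + a * b * X)"
      unfolding ab by (simp add: X_def field_simps)
    also have "(of_nat n)\<^sup>2 / 4 * e2 = ((\<Sum>j<n. s j)\<^sup>2 - (\<Sum>j<n. (s j)\<^sup>2)) / 2"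
      unfolding s1 s2 e2_def e1_def[symmetric] by (simp add: power_mult_distrib power_divide diff_divide_distrib algebra_simps)
    finally have "X * (l0 + l1 * (of_nat n / 2) * e1 + l2 * ((of_nat n)\<^sup>2 / 4) * e2) \<noteq> 0"
      using main c unfolding s1 X_def by simp
    then show ?thesis by auto
  qed
qed

section \<open>The operators B as multipliers and their duals\<close>

lemma poly_multiplier:
  "degree P \<le> n \<Longrightarrow> poly (multiplier \<gamma> P) z = (\<Sum>k\<le>n. \<gamma> k * coeff P k * z ^ k)"
proof -
  assume n: "degree P \<le> n"
  have "poly (multiplier \<gamma> P) z = (\<Sum>k\<le>degree P. \<gamma> k * coeff P k * z ^ k)"
    by (simp add: multiplier_def poly_sum poly_monom)
  also have "\<dots> = (\<Sum>k\<le>n. \<gamma> k * coeff P k * z ^ k)"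
    using n by (intro sum.mono_neutral_left) (auto simp: coeff_eq_0)
  finally show ?thesis .
qed

lemma poly_eq_sum:
  fixes P :: "complex poly"
  shows "degree P \<le> n \<Longrightarrow> poly P z = (\<Sum>k\<le>n. coeff P k * z ^ k)"
proof -
  assume "degree P \<le> n"
  moreover have "multiplier (\<lambda>_. 1) P = P" by (rule poly_eqI) simp
  ultimately show ?thesis using poly_multiplier[of P n "\<lambda>_. 1" z] by simp
qed

lemma euler_multiplier: "[:0, 1:] * pderiv P = multiplier of_nat P"
  by (rule poly_eqI) (auto simp: coeff_pCons coeff_pderiv split: nat.split)

lemma euler_multiplier2: "[:0, 1:] ^ 2 * pderiv (pderiv P) = multiplier (\<lambda>k. of_nat k * (of_nat k - 1)) P"
  by (rule poly_eqI) (auto simp: power2_eq_square coeff_pCons coeff_pderiv algebra_simps split: nat.split)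

text \<open>
  The eigenvalue of \<open>B\<close> at the monomial \<open>z\<^sup>k\<close>.
\<close>

definition B_symbol :: "nat \<Rightarrow> complex \<Rightarrow> complex \<Rightarrow> complex \<Rightarrow> nat \<Rightarrow> complex" where
  "B_symbol n l0 l1 l2 k =
     l0 + l1 * (of_nat n / 2) * of_nat k + l2 * ((of_nat n)\<^sup>2 / 8) * (of_nat k * (of_nat k - 1))"

lemma B_op_pcompose:
  "B_op n l0 l1 l2 (P \<circ>\<^sub>p [:0, of_real R:]) = multiplier (\<lambda>k. of_real R ^ k * B_symbol n l0 l1 l2 k) P"
proof -
  let ?Q = "P \<circ>\<^sub>p [:0, of_real R:]"
  have lin: "[:0, of_nat n / 2:] = smult (of_nat n / 2) [:0, 1 :: complex:]" by simp
  have lin2: "[:0, of_nat n / 2:] ^ 2 = smult ((of_nat n / 2)\<^sup>2) ([:0, 1 :: complex:] ^ 2)"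
    unfolding lin by (simp add: power2_eq_square)
  have 1: "[:0, of_nat n / 2:] * smult (1 / fact 1) (pderiv ?Q) = smult (of_nat n / 2) (multiplier of_nat ?Q)"
    unfolding lin euler_multiplier[symmetric] by simp
  have 2: "[:0, of_nat n / 2:] ^ 2 * smult (1 / fact 2) (pderiv (pderiv ?Q))
      = smult ((of_nat n)\<^sup>2 / 8) (multiplier (\<lambda>k. of_nat k * (of_nat k - 1)) ?Q)"
    unfolding lin2 euler_multiplier2[symmetric] by (simp add: power_divide)
  show ?thesis unfolding B_op_def 1 2
    by (intro poly_eqI) (simp add: B_symbol_def coeff_pcompose_linear field_simps)
qed

lemma B_symbol_0 [simp]: "B_symbol n l0 l1 l2 0 = l0"
  by (simp add: B_symbol_def)

lemma B_symbol_n: "B_symbol n l0 l1 l2 n = Lam n l0 l1 l2"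
  by (simp add: B_symbol_def Lam_def power2_eq_square power3_eq_cube mult.assoc)

lemma cnj_B_symbol: "cnj (B_symbol n l0 l1 l2 k) = B_symbol n (cnj l0) (cnj l1) (cnj l2) k"
  by (simp add: B_symbol_def)

lemma B_params_cnj:
  assumes "B_params n l0 l1 l2"
  shows "B_params n (cnj l0) (cnj l1) (cnj l2)"
  unfolding B_params_def
proof (intro allI impI)
  fix z assume z: "poly (U_poly n (cnj l0) (cnj l1) (cnj l2)) z = 0"
  have "poly (U_poly n l0 l1 l2) (cnj z) = cnj (poly (U_poly n (cnj l0) (cnj l1) (cnj l2)) z)"
    by (simp add: U_poly_def)
  with z have "poly (U_poly n l0 l1 l2) (cnj z) = 0" by simp
  then have "cmod (cnj z) \<le> cmod (cnj z - of_nat n / 2)"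
    using assms unfolding B_params_def by blast
  also have "cnj z - of_nat n / 2 = cnj (z - of_nat n / 2)" by simp
  finally show "cmod z \<le> cmod (z - of_nat n / 2)" by (simp only: complex_mod_cnj)
qed

text \<open>
  In terms of \<open>D = z d/dz\<close> the multipliers \<open>n - k\<close> and \<open>(n - k) (n - k - 1)\<close> are \<open>n - D\<close> and
  \<open>(n - D) (n - D - 1)\<close>.
\<close>

lemma poly_dual_symbol:
  assumes "degree P \<le> n"
  shows "poly (multiplier (\<lambda>k. B_symbol n l0 l1 l2 (n - k)) P) z =
     l0 * poly P z + l1 * (of_nat n / 2) * (of_nat n * poly P z - z * poly (pderiv P) z)
     + l2 * ((of_nat n)\<^sup>2 / 8) * (of_nat n * (of_nat n - 1) * poly P z
         - 2 * (of_nat n - 1) * (z * poly (pderiv P) z) + z\<^sup>2 * poly (pderiv (pderiv P)) z)"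
proof -
  have "multiplier (\<lambda>k. B_symbol n l0 l1 l2 (n - k)) P =
     smult l0 P + smult (l1 * (of_nat n / 2)) (smult (of_nat n) P - [:0, 1:] * pderiv P)
     + smult (l2 * ((of_nat n)\<^sup>2 / 8)) (smult (of_nat n * (of_nat n - 1)) P
         - smult (2 * (of_nat n - 1)) ([:0, 1:] * pderiv P) + [:0, 1:] ^ 2 * pderiv (pderiv P))"
  proof (rule poly_eqI)
    fix k
    show "coeff (multiplier (\<lambda>k. B_symbol n l0 l1 l2 (n - k)) P) k = coeff (
       smult l0 P + smult (l1 * (of_nat n / 2)) (smult (of_nat n) P - [:0, 1:] * pderiv P)
     + smult (l2 * ((of_nat n)\<^sup>2 / 8)) (smult (of_nat n * (of_nat n - 1)) P
         - smult (2 * (of_nat n - 1)) ([:0, 1:] * pderiv P) + [:0, 1:] ^ 2 * pderiv (pderiv P))) k"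
    proof (cases "k \<le> n")
      case True
      then show ?thesis
        unfolding euler_multiplier euler_multiplier2 by (simp add: B_symbol_def of_nat_diff field_simps)
    next
      case False
      then show ?thesis using assms
        unfolding euler_multiplier euler_multiplier2 by (simp add: coeff_eq_0)
    qed
  qed
  then show ?thesis by (simp add: power2_eq_square)
qed

text \<open>
  The numbers \<open>v\<^sub>j\<close> are \<open>z\<close> times the logarithmic derivatives of the factors \<open>1 - \<rho>\<^sub>j z\<close>, written so that
  \<open>1 - v\<^sub>j = 1 / (1 - \<rho>\<^sub>j z)\<close> is visible.
\<close>

lemma log_derivatives:
  fixes \<rho> :: "nat \<Rightarrow> complex"
  assumes nz: "\<And>j. j < m \<Longrightarrow> 1 - \<rho> j * z \<noteq> 0"
  defines "v \<equiv> \<lambda>j. 1 - 1 / (1 - \<rho> j * z)" and "Q \<equiv> \<lambda>m. \<Prod>j<m. [:1, -\<rho> j:]"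
  shows "z * poly (pderiv (Q m)) z = poly (Q m) z * (\<Sum>j<m. v j)"
    and "z\<^sup>2 * poly (pderiv (pderiv (Q m))) z = poly (Q m) z * ((\<Sum>j<m. v j)\<^sup>2 - (\<Sum>j<m. (v j)\<^sup>2))"
proof -
  have "z * poly (pderiv (Q m)) z = poly (Q m) z * (\<Sum>j<m. v j) \<and>
    z\<^sup>2 * poly (pderiv (pderiv (Q m))) z = poly (Q m) z * ((\<Sum>j<m. v j)\<^sup>2 - (\<Sum>j<m. (v j)\<^sup>2))"
    using nz
  proof (induction m)
    case 0
    then show ?case by (simp add: Q_def)
  next
    case (Suc m)
    define L where "L = [:1, -\<rho> m:]"
    define V where "V = (\<Sum>j<m. v j)"
    define V2 where "V2 = (\<Sum>j<m. (v j)\<^sup>2)"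
    have IH: "z * poly (pderiv (Q m)) z = poly (Q m) z * V"
      "z\<^sup>2 * poly (pderiv (pderiv (Q m))) z = poly (Q m) z * (V\<^sup>2 - V2)"
      using Suc by (auto simp: V_def V2_def)
    have Q: "Q (Suc m) = Q m * L" by (simp add: Q_def L_def)
    have dL: "z * poly (pderiv L) z = poly L z * v m" "pderiv (pderiv L) = 0"
      using Suc.prems[of m] by (simp_all add: L_def v_def pderiv_pCons field_simps)
    have d1: "pderiv (Q (Suc m)) = Q m * pderiv L + L * pderiv (Q m)"
      unfolding Q by (rule pderiv_mult)
    have d2: "pderiv (pderiv (Q (Suc m))) = 2 * pderiv L * pderiv (Q m) + L * pderiv (pderiv (Q m))"
      unfolding d1 by (simp add: pderiv_add pderiv_mult dL(2) algebra_simps)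
    have "z * poly (pderiv (Q (Suc m))) z = poly (Q m) z * (z * poly (pderiv L) z) + poly L z * (z * poly (pderiv (Q m)) z)"
      unfolding d1 by (simp add: algebra_simps)
    also have "\<dots> = poly (Q (Suc m)) z * (V + v m)"
      unfolding IH dL Q by (simp add: algebra_simps)
    finally have 1: "z * poly (pderiv (Q (Suc m))) z = poly (Q (Suc m)) z * (V + v m)" .
    have "z\<^sup>2 * poly (pderiv (pderiv (Q (Suc m)))) z
      = 2 * (z * poly (pderiv L) z) * (z * poly (pderiv (Q m)) z) + poly L z * (z\<^sup>2 * poly (pderiv (pderiv (Q m))) z)"
      unfolding d2 by (simp add: algebra_simps power2_eq_square)
    also have "\<dots> = poly (Q (Suc m)) z * ((V + v m)\<^sup>2 - (V2 + (v m)\<^sup>2))"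
      unfolding IH dL Q by (simp add: algebra_simps power2_eq_square)
    finally show ?case using 1 by (simp add: V_def V2_def)
  qed
  then show "z * poly (pderiv (Q m)) z = poly (Q m) z * (\<Sum>j<m. v j)"
    "z\<^sup>2 * poly (pderiv (pderiv (Q m))) z = poly (Q m) z * ((\<Sum>j<m. v j)\<^sup>2 - (\<Sum>j<m. (v j)\<^sup>2))"
    by auto
qed

lemma Re_inverse_one_minus: "Re (1 / (1 - x)) > 1 / 2" if "cmod x < 1"
proof -
  have "(cmod x)\<^sup>2 < 1" using that by (simp add: abs_square_less_1)
  then have x: "(Re x)\<^sup>2 + (Im x)\<^sup>2 < 1" by (simp add: cmod_power2)
  have "Re x < 1" using complex_Re_le_cmod[of x] that by linarith
  then have pos: "(1 - Re x)\<^sup>2 + (Im x)\<^sup>2 > 0" by (intro add_pos_nonneg) auto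
  have eq: "Re (1 / (1 - x)) = (1 - Re x) / ((1 - Re x)\<^sup>2 + (Im x)\<^sup>2)"
    by (simp add: Re_divide)
  have "(1 - Re x)\<^sup>2 + (Im x)\<^sup>2 < 2 * (1 - Re x)"
    using x by (simp add: power2_eq_square algebra_simps)
  then show ?thesis unfolding eq using pos by (simp add: less_divide_eq)
qed

text \<open>
  With \<open>w\<^sub>j = 1 / (1 - \<rho>\<^sub>j z)\<close> the operators \<open>n - D\<close> and \<open>(n - D) (n - D - 1)\<close>, where
  \<open>D = z d/dz\<close>, multiply \<open>P\<close> by \<open>\<Sum> w\<^sub>j\<close> and by \<open>(\<Sum> w\<^sub>j)\<^sup>2 - \<Sum> w\<^sub>j\<^sup>2\<close>, so the quotient by \<open>P\<close> is a polar form
  with all \<open>w\<^sub>j\<close> in the half plane \<open>Re w > 1/2\<close>.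
\<close>

lemma dual_symbol_nonzero:
  assumes n: "n \<ge> 1" and B: "B_params n l0 l1 l2" and P: "zero_free P" "degree P \<le> n"
    and z: "cmod z < 1"
  shows "poly (multiplier (\<lambda>k. B_symbol n l0 l1 l2 (n - k)) P) z \<noteq> 0"
proof -
  obtain c \<rho> where c: "c \<noteq> 0" and \<rho>: "\<And>j. cmod (\<rho> j) \<le> 1"
    and Pc: "P = smult c (\<Prod>j<n. [:1, -\<rho> j:])"
    using zero_free_factorization[OF P] by metis
  define w where "w j = 1 / (1 - \<rho> j * z)" for j
  have small: "cmod (\<rho> j * z) < 1" for j
    using mult_left_le[OF \<rho>[of j] norm_ge_zero[of z]] z by (simp add: norm_mult mult.commute)
  then have w: "Re (w j) > 1 / 2" for j unfolding w_def by (rule Re_inverse_one_minus)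
  have nz: "1 - \<rho> j * z \<noteq> 0" for j using small[of j] by auto
  define e1 where "e1 = (\<Sum>j<n. w j)"
  define p2 where "p2 = (\<Sum>j<n. (w j)\<^sup>2)"
  have v1: "(\<Sum>j<n. 1 - 1 / (1 - \<rho> j * z)) = of_nat n - e1"
    by (simp add: sum_subtractf e1_def w_def)
  have v2: "(\<Sum>j<n. (1 - 1 / (1 - \<rho> j * z))\<^sup>2) = of_nat n - 2 * e1 + p2"
    unfolding w_def[symmetric] by (simp add: power2_diff sum.distrib sum_subtractf e1_def p2_def sum_distrib_left)
  note L = log_derivatives[of n \<rho> z, OF nz, unfolded v1 v2]
  have PQ: "poly P z = c * poly (\<Prod>j<n. [:1, -\<rho> j:]) z" by (simp add: Pc)
  have D1: "z * poly (pderiv P) z = poly P z * (of_nat n - e1)"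
    unfolding PQ mult.assoc L(1)[symmetric] by (simp add: Pc pderiv_smult)
  have D2: "z\<^sup>2 * poly (pderiv (pderiv P)) z = poly P z * ((of_nat n - e1)\<^sup>2 - (of_nat n - 2 * e1 + p2))"
    unfolding PQ mult.assoc L(2)[symmetric] by (simp add: Pc pderiv_smult)
  have "poly (multiplier (\<lambda>k. B_symbol n l0 l1 l2 (n - k)) P) z
    = poly P z * (l0 + l1 * (of_nat n / 2) * e1 + l2 * ((of_nat n)\<^sup>2 / 4) * ((e1\<^sup>2 - p2) / 2))"
    unfolding poly_dual_symbol[OF P(2)] D1 D2 by (simp add: field_simps power2_eq_square)
  moreover have "l0 + l1 * (of_nat n / 2) * e1 + l2 * ((of_nat n)\<^sup>2 / 4) * ((e1\<^sup>2 - p2) / 2) \<noteq> 0"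
    unfolding e1_def p2_def by (rule B_symbol_nonzero[OF n B w])
  moreover have "poly P z \<noteq> 0" using P z by (auto simp: zero_free_def)
  ultimately show ?thesis by simp
qed

text \<open>
  The multipliers of \<open>P \<mapsto> B[P\<^sup>* \<circ> \<sigma>]\<^sup>*\<close>, where \<open>\<^sup>*\<close> is the conjugate reversal of degree \<open>n\<close>.
\<close>

definition dual_symbol :: "nat \<Rightarrow> complex \<Rightarrow> complex \<Rightarrow> complex \<Rightarrow> real \<Rightarrow> nat \<Rightarrow> complex" where
  "dual_symbol n l0 l1 l2 R k = of_real R ^ (n - k) * cnj (B_symbol n l0 l1 l2 (n - k))"

lemma dual_symbol_multiplier_nonzero:
  assumes n: "n \<ge> 1" and B: "B_params n l0 l1 l2" and P: "zero_free P" "degree P \<le> n"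
    and R: "R > 0" and z: "cmod z < R"
  shows "poly (multiplier (dual_symbol n l0 l1 l2 R) P) z \<noteq> 0"
proof -
  let ?u = "\<lambda>k. B_symbol n (cnj l0) (cnj l1) (cnj l2) (n - k)"
  have "poly (multiplier (dual_symbol n l0 l1 l2 R) P) z
      = of_real R ^ n * poly (multiplier ?u P) (z / of_real R)"
    unfolding poly_multiplier[OF P(2)] sum_distrib_left
  proof (rule sum.cong)
    fix k assume "k \<in> {..n}"
    then have "complex_of_real R ^ n = of_real R ^ (n - k) * of_real R ^ k"
      by (simp flip: power_add)
    then show "dual_symbol n l0 l1 l2 R k * coeff P k * z ^ k
        = of_real R ^ n * (?u k * coeff P k * (z / of_real R) ^ k)"
      using R by (simp add: dual_symbol_def cnj_B_symbol power_divide)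
  qed simp
  moreover have "poly (multiplier ?u P) (z / of_real R) \<noteq> 0"
    using z R by (intro dual_symbol_nonzero n B_params_cnj B P) (simp add: norm_divide)
  ultimately show ?thesis using R by simp
qed

definition reversal :: "nat \<Rightarrow> complex poly \<Rightarrow> complex poly" where
  "reversal n P = (\<Sum>k\<le>n. monom (cnj (coeff P (n - k))) k)"

lemma coeff_reversal: "coeff (reversal n P) k = (if k \<le> n then cnj (coeff P (n - k)) else 0)"
  by (auto simp: reversal_def coeff_sum)

lemma degree_reversal: "degree (reversal n P) \<le> n"
  by (rule degree_le) (simp add: coeff_reversal)

lemma poly_reversal:
  assumes "degree P \<le> n" "z \<noteq> 0"
  shows "poly (reversal n P) z = z ^ n * cnj (poly P (1 / cnj z))"
proof -
  have "poly (reversal n P) z = (\<Sum>k\<le>n. cnj (coeff P (n - k)) * z ^ k)"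
    by (simp add: reversal_def poly_sum poly_monom)
  also have "\<dots> = (\<Sum>k\<le>n. cnj (coeff P k) * z ^ (n - k))"
    by (rule sum.reindex_bij_witness[of _ "\<lambda>k. n - k" "\<lambda>k. n - k"]) auto
  also have "\<dots> = z ^ n * cnj (poly P (1 / cnj z))"
    using assms(2)
    by (simp add: poly_eq_sum[OF assms(1)] sum_distrib_left power_diff power_divide mult_ac)
  finally show ?thesis .
qed

text \<open>
  Reversal replaces each factor \<open>1 - \<rho>\<^sub>j z\<close> by its reflection \<open>z - cnj \<rho>\<^sub>j\<close>, which is no larger in the disc.
\<close>

lemma reversal_le:
  assumes P: "zero_free P" "degree P \<le> n" and z: "cmod z \<le> 1"
  shows "cmod (poly (reversal n P) z) \<le> cmod (poly P z)"
proof (rule poly_le_cball[OF _ z])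
  fix z :: complex assume z: "0 < cmod z" "cmod z < 1"
  obtain c \<rho> where c: "c \<noteq> 0" and \<rho>: "\<And>j. cmod (\<rho> j) \<le> 1"
    and Pc: "P = smult c (\<Prod>j<n. [:1, -\<rho> j:])"
    using zero_free_factorization[OF P] by metis
  have "poly (reversal n P) z = z ^ n * (cnj c * (\<Prod>j<n. 1 - cnj (\<rho> j) / z))"
    using z by (subst poly_reversal[OF P(2)]) (auto simp: Pc poly_prod mult.commute)
  also have "\<dots> = cnj c * (\<Prod>j<n. z * (1 - cnj (\<rho> j) / z))"
    by (simp add: prod.distrib)
  also have "\<dots> = cnj c * (\<Prod>j<n. z - cnj (\<rho> j))"
    using z by (simp add: right_diff_distrib)
  finally have "cmod (poly (reversal n P) z) = cmod c * (\<Prod>j<n. cmod (z - cnj (\<rho> j)))"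
    by (simp add: norm_mult prod_norm)
  also have "\<dots> \<le> cmod c * (\<Prod>j<n. cmod (1 - \<rho> j * z))"
    using cmod_diff_le_reflected[of "cnj (\<rho> _)" z] \<rho> z
    by (intro mult_left_mono prod_mono) auto
  also have "\<dots> = cmod (poly P z)"
    by (simp add: Pc poly_prod norm_mult prod_norm mult.commute)
  finally show "cmod (poly (reversal n P) z) \<le> cmod (poly P z)" .
qed

lemma dual_preserves_zero_free:
  assumes "n \<ge> 1" "B_params n l0 l1 l2" "R > 1"
  shows "preserves_zero_free n (dual_symbol n l0 l1 l2 R)"
  using dual_symbol_multiplier_nonzero[OF assms(1,2)] assms(3)
  by (auto simp: preserves_zero_free_def zero_free_def)

text \<open>
  On the circle \<open>|F|\<close> equals the modulus of the reversal of \<open>F\<close>, which is the image of \<open>P\<^sup>*\<close> under the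
  dual operator and hence dominated by \<open>G\<close>. The maximum principle for \<open>F / G\<close> gives the interior.
\<close>

lemma B_op_le_dual:
  assumes n: "n \<ge> 1" and B: "B_params n l0 l1 l2" and P: "zero_free P" "degree P \<le> n"
    and R: "R > 1" and z: "cmod z \<le> 1"
  defines "F \<equiv> B_op n l0 l1 l2 (P \<circ>\<^sub>p [:0, of_real R:])"
    and "G \<equiv> multiplier (dual_symbol n l0 l1 l2 R) P"
  shows "cmod (poly F z) \<le> cmod (poly G z)"
proof -
  have F: "F = multiplier (\<lambda>k. of_real R ^ k * B_symbol n l0 l1 l2 k) P"
    unfolding F_def by (rule B_op_pcompose)
  have G0: "poly G z \<noteq> 0" if "cmod z \<le> 1" for z
    unfolding G_def using that R by (intro dual_symbol_multiplier_nonzero n B P) auto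
  have circle: "cmod (poly F z) \<le> cmod (poly G z)" if z: "cmod z = 1" for z
  proof -
    have "degree F \<le> n" using degree_multiplier_le[of _ P] P(2) unfolding F by (rule order_trans)
    have "z \<noteq> 0" using z by auto
    moreover have "1 / cnj z = z" using z complex_norm_square[of z] \<open>z \<noteq> 0\<close>
      by (simp add: divide_eq_eq)
    ultimately have "cmod (poly F z) = cmod (poly (reversal n F) z)"
      using z \<open>degree F \<le> n\<close> by (simp add: poly_reversal norm_mult norm_power)
    also have "reversal n F = multiplier (dual_symbol n l0 l1 l2 R) (reversal n P)"
      by (rule poly_eqI) (auto simp: coeff_reversal F dual_symbol_def)
    also have "cmod (poly (multiplier (dual_symbol n l0 l1 l2 R) (reversal n P)) z) \<le> cmod (poly G z)"
      unfolding G_def using z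
      by (intro multiplier_comparison[OF dual_preserves_zero_free[OF n B R]] degree_reversal P reversal_le) auto
    finally show ?thesis .
  qed
  have "norm (poly F z / poly G z) \<le> 1"
  proof (rule maximum_modulus_frontier[where f = "\<lambda>z. poly F z / poly G z" and S = "cball 0 1"])
    show "(\<lambda>z. poly F z / poly G z) holomorphic_on interior (cball 0 1)"
      using G0 by (intro holomorphic_intros) auto
    show "continuous_on (closure (cball 0 1)) (\<lambda>z. poly F z / poly G z)"
      using G0 by (intro continuous_intros) auto
    show "norm (poly F y / poly G y) \<le> 1" if "y \<in> frontier (cball 0 1)" for y
      using that circle[of y] G0[of y] by (simp add: frontier_cball norm_divide divide_le_eq)
  qed (use z in auto)
  then show ?thesis using G0[OF z] by (simp add: norm_divide divide_le_eq)
qed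

section \<open>Averaging over the free unimodular factor\<close>

text \<open>
  Arestov's inequality for the multiplier that retains only the constant term.
\<close>

lemma mean_value_le:
  fixes P :: "complex poly"
  assumes p: "p > 0"
  shows "2 * pi * cmod (poly P 0) powr p \<le> (\<integral>\<theta>. cmod (poly P (cis \<theta>)) powr p \<partial>angle_measure)"
proof -
  let ?\<gamma> = "\<lambda>k::nat. if k = 0 then 1 else (0 :: complex)"
  have eq: "multiplier ?\<gamma> Q = [:poly Q 0:]" for Q
    by (rule poly_eqI) (simp add: coeff_pCons poly_0_coeff_0 split: nat.split)
  have "preserves_zero_free (degree P) ?\<gamma>"
    by (auto simp: preserves_zero_free_def eq zero_free_def)
  from arestov[OF this order.refl p] show ?thesis by (simp add: eq)
qed

text \<open>
  Arestov's inequality for linear polynomials: \<open>1 + s z \<mapsto> 1 + z\<close> is the multiplier with entries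
  \<open>1\<close> and \<open>1 / s\<close>, and it shrinks the inverse of the zero, so it keeps the disc free of zeros.
\<close>

lemma affine_average_mono:
  fixes s :: complex
  assumes p: "p > 0" and s: "cmod s \<ge> 1"
  shows "(\<integral>\<alpha>. cmod (1 + cis \<alpha>) powr p \<partial>angle_measure) \<le> (\<integral>\<alpha>. cmod (1 + s * cis \<alpha>) powr p \<partial>angle_measure)"
proof -
  let ?\<gamma> = "\<lambda>k::nat. if k = 0 then 1 else 1 / s"
  have s0: "s \<noteq> 0" using s by auto
  have "preserves_zero_free 1 ?\<gamma>"
    unfolding preserves_zero_free_def
  proof (intro allI impI)
    fix P assume P: "degree P \<le> 1" "zero_free P"
    obtain c \<rho> where c: "c \<noteq> 0" and \<rho>: "\<And>j. cmod (\<rho> j) \<le> 1"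
      and Pc: "P = smult c (\<Prod>j<(1::nat). [:1, -\<rho> j:])"
      using zero_free_factorization[OF P(2,1)] by metis
    have "P = [:c, - (c * \<rho> 0):]" using Pc by (simp add: lessThan_Suc)
    then have "multiplier ?\<gamma> P = [:c, - (c * \<rho> 0 / s):]"
      by (intro poly_eqI) (simp add: coeff_pCons split: nat.split)
    then have "multiplier ?\<gamma> P = [:c:] * [:1, -(\<rho> 0 / s):]" by simp
    moreover have "cmod (\<rho> 0) \<le> cmod s" using \<rho>[of 0] s by linarith
    then have "cmod (\<rho> 0 / s) \<le> 1" using s0 by (simp add: norm_divide divide_le_eq)
    moreover have "zero_free [:c:]" using c by (simp add: zero_free_def)
    ultimately show "zero_free (multiplier ?\<gamma> P)"
      by (simp only: zero_free_mult_iff zero_free_linear simp_thms)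
  qed
  from arestov[OF this, of "[:1, s:]" p]
  have "(\<integral>\<theta>. cmod (poly (multiplier ?\<gamma> [:1, s:]) (cis \<theta>)) powr p \<partial>angle_measure)
    \<le> (\<integral>\<theta>. cmod (1 + cis \<theta> * s) powr p \<partial>angle_measure)"
    using p by simp
  moreover have "multiplier ?\<gamma> [:1, s:] = [:1, 1:]"
    using s0 by (intro poly_eqI) (simp add: coeff_pCons split: nat.split)
  ultimately show ?thesis by (simp add: mult.commute[of _ s])
qed

lemma average_combination_ge:
  assumes p: "p > 0" and ab: "cmod a \<le> cmod b"
  shows "cmod a powr p * (\<integral>\<alpha>. cmod (1 + cis \<alpha>) powr p \<partial>angle_measure)
    \<le> (\<integral>\<alpha>. cmod (a + b * cis \<alpha>) powr p \<partial>angle_measure)"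
proof (cases "a = 0")
  case False
  have "cmod (a + b * cis \<alpha>) powr p = cmod a powr p * cmod (1 + b / a * cis \<alpha>) powr p" for \<alpha>
  proof -
    have "a + b * cis \<alpha> = a * (1 + b / a * cis \<alpha>)" using False by (simp add: field_simps)
    then have "cmod (a + b * cis \<alpha>) = cmod a * cmod (1 + b / a * cis \<alpha>)"
      by (metis norm_mult)
    then show ?thesis by (simp add: powr_mult)
  qed
  then have "(\<integral>\<alpha>. cmod (a + b * cis \<alpha>) powr p \<partial>angle_measure)
    = cmod a powr p * (\<integral>\<alpha>. cmod (1 + b / a * cis \<alpha>) powr p \<partial>angle_measure)"
    by simp
  moreover have "cmod (b / a) \<ge> 1" using ab False by (simp add: norm_divide le_divide_eq)
  note affine_average_mono[OF p this]
  ultimately show ?thesis by (simp add: mult_left_mono)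
qed (simp add: integral_nonneg)

text \<open>
  Inside the disc \<open>G\<close> does not vanish and \<open>|F| \<le> |G|\<close>, so \<open>F + \<omega> G = 0\<close> is impossible. Taking
  \<open>|\<omega>| > 1\<close> instead of \<open>|\<omega>| = 1\<close> avoids any discussion of equality.
\<close>

lemma combination_preserves_zero_free:
  assumes n: "n \<ge> 1" and B: "B_params n l0 l1 l2" and R: "R > 1" and \<omega>: "cmod \<omega> > 1"
  shows "preserves_zero_free n
    (\<lambda>k. of_real R ^ k * B_symbol n l0 l1 l2 k + \<omega> * dual_symbol n l0 l1 l2 R k)"
  unfolding preserves_zero_free_def
proof (intro allI impI)
  fix P assume P: "degree P \<le> n" "zero_free P"
  define F where "F = B_op n l0 l1 l2 (P \<circ>\<^sub>p [:0, of_real R:])"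
  define G where "G = multiplier (dual_symbol n l0 l1 l2 R) P"
  have eq: "multiplier (\<lambda>k. of_real R ^ k * B_symbol n l0 l1 l2 k + \<omega> * dual_symbol n l0 l1 l2 R k) P
    = F + smult \<omega> G"
    unfolding F_def G_def B_op_pcompose by (rule poly_eqI) (simp add: algebra_simps)
  show "zero_free (multiplier (\<lambda>k. of_real R ^ k * B_symbol n l0 l1 l2 k + \<omega> * dual_symbol n l0 l1 l2 R k) P)"
    unfolding eq zero_free_def
  proof (intro allI impI notI)
    fix z assume z: "cmod z < 1" and "poly (F + smult \<omega> G) z = 0"
    then have "poly F z = - (\<omega> * poly G z)" by (simp add: eq_neg_iff_add_eq_0)
    then have "cmod (poly F z) = cmod \<omega> * cmod (poly G z)" by (simp add: norm_mult)
    moreover have "cmod (poly G z) > 0"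
      unfolding G_def using dual_symbol_multiplier_nonzero[OF n B P(2,1)] R z by auto
    moreover have "cmod (poly F z) \<le> cmod (poly G z)"
      unfolding F_def G_def using z by (intro B_op_le_dual n B P R) auto
    ultimately show False using \<omega> by auto
  qed
qed

text \<open>
  The double integral of \<open>|F + \<tau> e\<^sup>i\<^sup>\<alpha> G|\<^sup>p\<close> over both angles is bounded from above by integrating
  first over \<open>\<theta>\<close> (Arestov's inequality) and from below by integrating first over \<open>\<alpha>\<close>, where
  \<open>|F| \<le> |G|\<close> enters. Finally \<open>\<tau>\<close> tends to \<open>1\<close>.
\<close>

lemma integral_B_op_le:
  assumes n: "n \<ge> 1" and B: "B_params n l0 l1 l2" and P: "zero_free P" "degree P \<le> n"
    and R: "R > 1" and p: "p > 0"
  defines "F \<equiv> B_op n l0 l1 l2 (P \<circ>\<^sub>p [:0, of_real R:])"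
    and "I \<equiv> \<lambda>Q. \<integral>\<theta>. cmod (poly Q (cis \<theta>)) powr p \<partial>angle_measure"
  shows "I F * I [:1, 1:] \<le> 2 * pi * (R ^ n * cmod (Lam n l0 l1 l2) + cmod l0) powr p * I P"
proof -
  define G where "G = multiplier (dual_symbol n l0 l1 l2 R) P"
  have le: "I F * I [:1, 1:] \<le> 2 * pi * (\<tau> * (R ^ n * cmod (Lam n l0 l1 l2)) + cmod l0) powr p * I P"
    if \<tau>: "\<tau> > 1" for \<tau>
  proof -
    define h where "h \<theta> \<alpha> = cmod (poly F (cis \<theta>) + (of_real \<tau> * poly G (cis \<theta>)) * cis \<alpha>) powr p" for \<theta> \<alpha>
    define C where "C = (\<tau> * (R ^ n * cmod (Lam n l0 l1 l2)) + cmod l0) powr p"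
    have hmeas [measurable]: "case_prod h \<in> borel_measurable (angle_measure \<Otimes>\<^sub>M angle_measure)"
      unfolding h_def by measurable
    have intI: "integrable angle_measure (\<lambda>\<theta>. cmod (poly Q (cis \<theta>)) powr p)" for Q
      by (intro integrable_angle_continuous continuous_on_powr_poly_cis p)
    have h1: "integrable angle_measure (h \<theta>)" for \<theta>
    proof -
      have "h \<theta> = (\<lambda>\<alpha>. cmod (poly [:poly F (cis \<theta>), of_real \<tau> * poly G (cis \<theta>):] (cis \<alpha>)) powr p)"
        by (rule ext) (simp add: h_def mult.commute)
      then show ?thesis by (simp only: intI)
    qed
    have h2: "(\<lambda>\<theta>. h \<theta> \<alpha>) = (\<lambda>\<theta>. cmod (poly (F + smult (of_real \<tau> * cis \<alpha>) G) (cis \<theta>)) powr p)" for \<alpha>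
      by (simp add: h_def mult_ac)
    have lower: "cmod (poly F (cis \<theta>)) powr p * I [:1, 1:] \<le> (\<integral>\<alpha>. h \<theta> \<alpha> \<partial>angle_measure)" for \<theta>
    proof -
      have "cmod (poly F (cis \<theta>)) \<le> cmod (poly G (cis \<theta>))"
        unfolding F_def G_def by (intro B_op_le_dual n B P R) auto
      also have "\<dots> \<le> cmod (of_real \<tau> * poly G (cis \<theta>))"
        using \<tau> by (simp add: norm_mult mult_le_cancel_right1)
      finally show ?thesis unfolding h_def I_def using average_combination_ge[OF p] by simp
    qed
    have upper: "(\<integral>\<theta>. h \<theta> \<alpha> \<partial>angle_measure) \<le> C * I P" for \<alpha>
    proof -
      define \<omega> where "\<omega> = of_real \<tau> * cis \<alpha>"
      have \<omega>: "cmod \<omega> = \<tau>" using \<tau> by (simp add: \<omega>_def norm_mult)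
      let ?\<gamma> = "\<lambda>k. of_real R ^ k * B_symbol n l0 l1 l2 k + \<omega> * dual_symbol n l0 l1 l2 R k"
      have "multiplier ?\<gamma> P = F + smult \<omega> G"
        unfolding F_def G_def B_op_pcompose by (rule poly_eqI) (simp add: algebra_simps)
      moreover have "preserves_zero_free n ?\<gamma>"
        using \<omega> \<tau> by (intro combination_preserves_zero_free n B R) auto
      from arestov[OF this P(2) p]
      have "(\<integral>\<theta>. cmod (poly (multiplier ?\<gamma> P) (cis \<theta>)) powr p \<partial>angle_measure) \<le> cmod (?\<gamma> 0) powr p * I P"
        unfolding I_def .
      moreover have "cmod (?\<gamma> 0) powr p * I P \<le> C * I P"
      proof (intro mult_right_mono)
        have "cmod (?\<gamma> 0) \<le> cmod l0 + cmod (\<omega> * (of_real R ^ n * cnj (Lam n l0 l1 l2)))"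
          using norm_triangle_ineq[of l0 "\<omega> * (of_real R ^ n * cnj (Lam n l0 l1 l2))"]
          by (simp add: dual_symbol_def B_symbol_n)
        also have "\<dots> = \<tau> * (R ^ n * cmod (Lam n l0 l1 l2)) + cmod l0"
          using \<omega> R by (simp add: norm_mult norm_power)
        finally show "cmod (?\<gamma> 0) powr p \<le> C" unfolding C_def using p by (intro powr_mono2) auto
      qed (simp add: I_def integral_nonneg)
      ultimately show ?thesis unfolding h2 \<omega>_def by (simp add: \<omega>_def)
    qed
    have hnn: "h \<theta> \<alpha> \<ge> 0" for \<theta> \<alpha> by (simp add: h_def)
    have h2i: "integrable angle_measure (\<lambda>\<theta>. h \<theta> \<alpha>)" for \<alpha> unfolding h2 by (rule intI)
    have I0: "I Q \<ge> 0" for Q by (simp add: I_def integral_nonneg)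
    have "ennreal (I F * I [:1, 1:]) = (\<integral>\<^sup>+\<theta>. ennreal (cmod (poly F (cis \<theta>)) powr p * I [:1, 1:]) \<partial>angle_measure)"
      using intI[of F] I0 by (subst nn_integral_eq_integral) (auto simp: I_def)
    also have "\<dots> \<le> (\<integral>\<^sup>+\<theta>. ennreal (\<integral>\<alpha>. h \<theta> \<alpha> \<partial>angle_measure) \<partial>angle_measure)"
      by (intro nn_integral_mono ennreal_leI lower)
    also have "\<dots> = (\<integral>\<^sup>+\<theta>. (\<integral>\<^sup>+\<alpha>. ennreal (h \<theta> \<alpha>) \<partial>angle_measure) \<partial>angle_measure)"
      using h1 hnn by (intro nn_integral_cong nn_integral_eq_integral[symmetric]) auto
    also have "\<dots> = (\<integral>\<^sup>+\<alpha>. (\<integral>\<^sup>+\<theta>. ennreal (h \<theta> \<alpha>) \<partial>angle_measure) \<partial>angle_measure)"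
      by (rule angle_pair.Fubini'[symmetric]) measurable
    also have "\<dots> = (\<integral>\<^sup>+\<alpha>. ennreal (\<integral>\<theta>. h \<theta> \<alpha> \<partial>angle_measure) \<partial>angle_measure)"
      using h2i hnn by (intro nn_integral_cong nn_integral_eq_integral) auto
    also have "\<dots> \<le> (\<integral>\<^sup>+\<alpha>. ennreal (C * I P) \<partial>angle_measure)"
      by (intro nn_integral_mono ennreal_leI upper)
    also have "\<dots> = ennreal (2 * pi * C * I P)"
      using I0[of P] by (simp add: emeasure_angle_measure C_def mult_ac flip: ennreal_mult')
    finally show ?thesis using I0[of P] by (simp add: C_def)
  qed
  have "((\<lambda>\<tau>. 2 * pi * (\<tau> * (R ^ n * cmod (Lam n l0 l1 l2)) + cmod l0) powr p * I P)
     \<longlongrightarrow> 2 * pi * (1 * (R ^ n * cmod (Lam n l0 l1 l2)) + cmod l0) powr p * I P) (at_right 1)"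
    using p R by (intro tendsto_intros tendsto_powr') (auto intro!: eventually_at_rightI[of 1 2] add_nonneg_nonneg)
  moreover have "\<forall>\<^sub>F \<tau> in at_right 1. I F * I [:1, 1:] \<le>
      2 * pi * (\<tau> * (R ^ n * cmod (Lam n l0 l1 l2)) + cmod l0) powr p * I P"
    using le by (intro eventually_at_rightI[of 1 2]) auto
  ultimately show ?thesis
    using tendsto_lowerbound[of _ _ "at_right (1::real)"] by fastforce
qed

section \<open>The norm inequality\<close>

lemma circle_norm_pos:
  assumes "p > 0"
  shows "circle_norm p Q = (1 / (2 * pi) * (\<integral>\<theta>. cmod (poly Q (cis \<theta>)) powr p \<partial>angle_measure)) powr (1 / p)"
  using assms unfolding circle_norm_def by (subst set_integral_angle) auto

lemma circle_norm_0:
  assumes "Q \<noteq> 0"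
  shows "circle_norm 0 Q = exp (1 / (2 * pi) * (\<integral>\<theta>. ln (cmod (poly Q (cis \<theta>))) \<partial>angle_measure))"
  using assms unfolding circle_norm_def by (subst set_integral_angle) auto

lemma circle_norm_0_zero_free:
  assumes "zero_free Q"
  shows "circle_norm 0 Q = cmod (poly Q 0)"
proof -
  have "poly Q 0 \<noteq> 0" using assms by (simp add: zero_free_def)
  then show ?thesis
    using has_bochner_integral_integral_eq[OF mahler_zero_free[OF assms]]
    by (simp add: circle_norm_0 zero_free_not_0[OF assms])
qed

theorem corollary3:
  fixes n :: nat and P :: "complex poly" and l0 l1 l2 :: complex and p R :: real
  assumes "n \<ge> 1"
    and "degree P \<le> n"
    and "\<And>z. cmod z < 1 \<Longrightarrow> poly P z \<noteq> 0"
    and "B_params n l0 l1 l2"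
    and "0 \<le> p"
    and "R > 1"
  shows "circle_norm p (B_op n l0 l1 l2 (P \<circ>\<^sub>p [:0, of_real R:]))
     \<le> (R ^ n * cmod (Lam n l0 l1 l2) + cmod l0) / circle_norm p [:1, 1:] * circle_norm p P"
proof -
  define F where "F = B_op n l0 l1 l2 (P \<circ>\<^sub>p [:0, of_real R:])"
  define C where "C = R ^ n * cmod (Lam n l0 l1 l2) + cmod l0"
  have P: "zero_free P" using assms(3) by (simp add: zero_free_def)
  have C: "C \<ge> 0" using assms(6) by (simp add: C_def)
  have "circle_norm p F \<le> C / circle_norm p [:1, 1:] * circle_norm p P"
  proof (cases "p = 0")
    case True
    have "zero_free [:1, 1:]" using zero_free_linear[of "-1"] by simp
    then have one: "circle_norm 0 [:1, 1:] = 1" by (simp add: circle_norm_0_zero_free)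
    have "circle_norm 0 F \<le> C * circle_norm 0 P"
    proof (cases "F = 0")
      case True
      then show ?thesis using C by (simp add: circle_norm_def)
    next
      case False
      define G where "G = multiplier (dual_symbol n l0 l1 l2 R) P"
      have G: "zero_free G"
        using dual_preserves_zero_free[OF assms(1,4,6)] P assms(2)
        by (simp add: preserves_zero_free_def G_def)
      have "(\<integral>\<theta>. ln (cmod (poly F (cis \<theta>))) \<partial>angle_measure) \<le> (\<integral>\<theta>. ln (cmod (poly G (cis \<theta>))) \<partial>angle_measure)"
      proof (rule integral_mono_AE)
        show "AE \<theta> in angle_measure. ln (cmod (poly F (cis \<theta>))) \<le> ln (cmod (poly G (cis \<theta>)))"
          using AE_poly_cis_nonzero[OF False]
        proof eventually_elim
          fix \<theta> assume "poly F (cis \<theta>) \<noteq> 0"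
          moreover have "cmod (poly F (cis \<theta>)) \<le> cmod (poly G (cis \<theta>))"
            unfolding F_def G_def using P assms by (intro B_op_le_dual) auto
          ultimately show "ln (cmod (poly F (cis \<theta>))) \<le> ln (cmod (poly G (cis \<theta>)))"
            by (intro ln_mono) auto
        qed
      qed (use False zero_free_not_0[OF G] in \<open>auto intro: integrable_ln_poly\<close>)
      then have "circle_norm 0 F \<le> circle_norm 0 G"
        using False zero_free_not_0[OF G] by (simp add: circle_norm_0 divide_right_mono)
      also have "\<dots> = R ^ n * cmod (Lam n l0 l1 l2) * circle_norm 0 P"
        using assms(6) unfolding circle_norm_0_zero_free[OF G] circle_norm_0_zero_free[OF P]
        by (simp add: G_def poly_multiplier_0 dual_symbol_def B_symbol_n norm_mult norm_power)
      also have "\<dots> \<le> C * circle_norm 0 P"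
        by (intro mult_right_mono) (auto simp: C_def circle_norm_0_zero_free[OF P])
      finally show ?thesis .
    qed
    then show ?thesis using True one by simp
  next
    case False
    then have p: "p > 0" using assms(5) by simp
    define I where "I Q = (\<integral>\<theta>. cmod (poly Q (cis \<theta>)) powr p \<partial>angle_measure)" for Q
    have I0: "I Q \<ge> 0" for Q by (simp add: I_def integral_nonneg)
    have "2 * pi \<le> I [:1, 1:]" using mean_value_le[OF p, of "[:1, 1:]"] by (simp add: I_def)
    then have I1: "I [:1, 1:] > 0" using pi_gt_zero by linarith
    have "I F * I [:1, 1:] \<le> 2 * pi * C powr p * I P"
      unfolding F_def I_def C_def by (rule integral_B_op_le[OF assms(1,4) P assms(2,6) p])
    then have "(1 / (2 * pi) * I F) * (1 / (2 * pi) * I [:1, 1:]) \<le> C powr p * (1 / (2 * pi) * I P)"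
      by (simp add: field_simps)
    then have "((1 / (2 * pi) * I F) * (1 / (2 * pi) * I [:1, 1:])) powr (1 / p)
        \<le> (C powr p * (1 / (2 * pi) * I P)) powr (1 / p)"
      using p I0 by (intro powr_mono2) auto
    also have "\<dots> = (C powr p) powr (1 / p) * (1 / (2 * pi) * I P) powr (1 / p)"
      by (rule powr_mult)
    also have "(C powr p) powr (1 / p) = C" using C p by (simp add: powr_powr)
    also have "((1 / (2 * pi) * I F) * (1 / (2 * pi) * I [:1, 1:])) powr (1 / p)
        = (1 / (2 * pi) * I F) powr (1 / p) * (1 / (2 * pi) * I [:1, 1:]) powr (1 / p)"
      by (rule powr_mult)
    finally have "circle_norm p F * circle_norm p [:1, 1:] \<le> C * circle_norm p P"
      by (simp only: circle_norm_pos[OF p] I_def)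
    moreover have "circle_norm p [:1, 1:] > 0"
      unfolding circle_norm_pos[OF p] I_def[symmetric] using I1 by simp
    ultimately show ?thesis by (simp add: le_divide_eq)
  qed
  then show ?thesis by (simp add: F_def C_def)
qed

end
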